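(* Let $\alpha,\lambda>0$, $\chi=\alpha\lambda$, let $E$ be one of $\mathbb{R}$, $\mathbb{R}^+$, $[0,\infty)$, and let $X$ be the realization of an $\alpha$-self-similar Feller semigroup $(P_t)_{t\ge 0}$ on $E$, with laws $(\mathbb{P}_x)_{x\in E}$. Let $(Q_t)_{t\ge0}$ be the associated Ornstein-Uhlenbeck semigroup and $U$ its realization. (1) If $E=\mathbb{R}$ or condition $\mathbf{H0}$ (see context) holds, then the Feller process $U$ is positively recurrent and its unique invariant measure is $\chi\,\mathbb{P}_0(X_1\in dx)$. (2) Next, assume that $\mathcal{I}\in L^1(\gamma(dr))$. For any $q>0$, introduce the function $\mathcal{I}(q;x)$ defined by $$\mathcal{I}(q;x)=\chi^{\frac{q}{\chi}}\,\mathbb{E}\left[\mathcal{I}\left(\left(\chi G_{\frac q\chi}\right)^{\frac1\alpha}x\right)\right],\qquad x\in E.$$ If $\mathcal{I}$ is $1$-invariant (resp. $1$-excessive) for $(P_t)_{t\ge0}$, then $x\mapsto\mathcal{I}(q;x)$ is $q$-invariant (resp. $q$-excessive) for $(Q_t)_{t\ge0}$. (3) Consequently, if $\mathcal{I}$ is $1$-invariant for $(P_t)_{t\ge0}$, then for any $q>0$, $$(1+\chi t)^{-\frac q\chi}\,P_t\Big(d_{(1+\chi t)^{-1/\alpha}}\,\mathcal{I}(q;\cdot)\Big)(x)=\mathcal{I}(q;x),\qquad x\in E,\ t\ge 0.$$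
   Context: Self-similarity: $d_c$ denotes the dilatation operator $d_cf(x)=f(cx)$. The Feller semigroup $(P_t)$ is $\alpha$-self-similar if for all $c>0$, $t\ge0$, $x\in E$ and all bounded Borel $f$ on $E$, $P_{c^\alpha t}f(cx)=P_t(d_cf)(x)$. The situations in mind are: $E=\mathbb{R}$ and $X$ an $\alpha$-stable Lévy process; or $E=\mathbb{R}^+$ or $[0,\infty)$ and $X$ a $\frac1\alpha$-semi-stable process. $\mathbb{E}$ is a reference expectation operator. Semi-stable processes: let $\xi$ be a Lévy process on $\mathbb{R}$ that is not arithmetic and satisfies $-\infty<b:=\mathbb{E}[\xi_1]<\infty$ (moments of $\xi_1$ refer to $\xi_0=0$). The associated $\frac1\alpha$-semi-stable positive Markov process is given by the Lamperti mapping $X_t=e^{\xi_{A_t}}$, $A_t=\inf\{u\ge0: \int_0^u e^{\alpha\xi_s}ds>t\}$, with $X_0=e^{\xi_0}$. If $b>0$ (or $b\ge0$ and $\xi$ is spectrally negative), $X$ has infinite lifetime and $\mathbb{P}_x$ converges in the sense of finite-dimensional distributions, as $x\to0+$, to a probability measure denoted $\mathbb{P}_0$. If $b<0$, $X$ has finite lifetime $T_0^X=\inf\{u\ge0: X_{u-}=0,X_u=0\}$. If moreover there is a unique $\theta>0$ with $\mathbb{E}[e^{\theta\xi_1}]=1$ (Cramér's condition) and $0<\theta<\alpha$, the minimal process $(X,T_0^X)$ admits a unique recurrent extension that hits and leaves $0$ continuously a.s. and is a $\frac1\alpha$-semi-stable process on $[0,\infty)$; $\mathbb{P}_x$ then denotes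 the laws of this extension. Condition $\mathbf{H0}$: $E=[0,\infty)$ and either $b>0$, or $b<0$ and Cramér's condition holds with $\theta<\alpha$; moreover, if $\xi$ is spectrally negative, the case $b=0$ is also allowed. Ornstein-Uhlenbeck semigroup: for bounded Borel $f$ on $E$, $Q_tf(x)=P_{e_\chi(t)}(d_{e^{-\lambda t}}f)(x)$, where $e_\chi(t)=\frac{e^{\chi t}-1}{\chi}$. It is a Feller semigroup, with realization $U_t=e^{-\lambda t}X_{e_\chi(t)}$. A probability measure $m$ is invariant for $U$ if $\int_E Q_tf\,dm=\int_E f\,dm$ for all bounded Borel $f$ on $E$. Excessive and invariant functions: for $r>0$, a non-negative function $h$ is $r$-excessive (resp. $r$-invariant) for a semigroup $(S_t)$ if $e^{-rt}S_th\le h$ (resp. $e^{-rt}S_th=h$) for all $t>0$, and $\lim_{t\downarrow0}e^{-rt}S_th(x)=h(x)$ pointwise. Gamma variable: for $q>0$, $G_q$ is a Gamma random variable with parameter $q$, independent of $X$, whose law is $\gamma(dr)=\frac{e^{-r}r^{q-1}}{\Gamma(q)}dr$ on $(0,\infty)$.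
   Formalization: The invariant measure is taken to be the law of χ^{-1/α}X_1 under P_0 (χP_0(X_1∈dx) has mass χ and fails for χ≠1, e.g. Brownian motion); "positively recurrent" means an invariant probability exists and every open set it charges is a.s. occupied for infinite time. *)

theory Defs
  imports "HOL-Probability.Probability"
begin

section \<open>Self-similar Feller semigroups and their realizations\<close>

text \<open>The state space is a Borel set \<open>E\<close> of reals. A transition semigroup is given by its kernels
  \<open>K t x\<close>, measures on the Borel sets of \<open>E\<close>. It acts on bounded Borel functions through the
  Bochner integral, and on non-negative (possibly infinite) functions through the non-negative
  integral.\<close>

abbreviation borel_on :: "real set \<Rightarrow> real measure" where
  "borel_on E \<equiv> restrict_space borel E"

definition bounded_borel :: "real set \<Rightarrow> (real \<Rightarrow> real) \<Rightarrow> bool" where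
  "bounded_borel E f \<longleftrightarrow> f \<in> borel_measurable (borel_on E) \<and> bounded (f ` E)"

definition real_op :: "(real \<Rightarrow> real \<Rightarrow> real measure) \<Rightarrow> real \<Rightarrow> (real \<Rightarrow> real) \<Rightarrow> real \<Rightarrow> real" where
  "real_op K t f x = (\<integral>y. f y \<partial>(K t x))"

definition nn_op :: "(real \<Rightarrow> real \<Rightarrow> real measure) \<Rightarrow> real \<Rightarrow> (real \<Rightarrow> ennreal) \<Rightarrow> real \<Rightarrow> ennreal" where
  "nn_op K t h x = (\<integral>\<^sup>+y. h y \<partial>(K t x))"

text \<open>\<open>C\<^sub>0(E)\<close>: continuous functions on \<open>E\<close> vanishing at infinity in the locally compact space \<open>E\<close>
  (so also near \<open>0\<close> when \<open>E = {0<..}\<close>).\<close>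

definition C0 :: "real set \<Rightarrow> (real \<Rightarrow> real) set" where
  "C0 E = {f. continuous_on E f \<and>
              (\<forall>e>0. \<exists>C\<subseteq>E. compact C \<and> (\<forall>x\<in>E - C. \<bar>f x\<bar> < e))}"

text \<open>The kernels are only required to be sub-Markovian, so killed processes are included.\<close>

definition feller_semigroup :: "real set \<Rightarrow> (real \<Rightarrow> real \<Rightarrow> real measure) \<Rightarrow> bool" where
  "feller_semigroup E K \<longleftrightarrow>
     (\<forall>t\<ge>0. K t \<in> borel_on E \<rightarrow>\<^sub>M subprob_algebra (borel_on E)) \<and>
     (\<forall>x\<in>E. K 0 x = return (borel_on E) x) \<and>
     (\<forall>s\<ge>0. \<forall>t\<ge>0. \<forall>x\<in>E. K (s + t) x = K s x \<bind> K t) \<and>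
     (\<forall>t\<ge>0. \<forall>f\<in>C0 E. real_op K t f \<in> C0 E) \<and>
     (\<forall>f\<in>C0 E. uniform_limit E (\<lambda>t. real_op K t f) f (at_right 0))"

definition dil :: "real \<Rightarrow> (real \<Rightarrow> 'a) \<Rightarrow> real \<Rightarrow> 'a" where
  "dil c f x = f (c * x)"

definition self_similar :: "real \<Rightarrow> real set \<Rightarrow> (real \<Rightarrow> real \<Rightarrow> real measure) \<Rightarrow> bool" where
  "self_similar \<alpha> E K \<longleftrightarrow>
     (\<forall>c>0. \<forall>t\<ge>0. \<forall>x\<in>E. \<forall>f. bounded_borel E f \<longrightarrow>
        real_op K (c powr \<alpha> * t) f (c * x) = real_op K t (dil c f) x)"

definition cadlag :: "(real \<Rightarrow> real) \<Rightarrow> bool" where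
  "cadlag f \<longleftrightarrow>
     (\<forall>t\<ge>0. (f \<longlongrightarrow> f t) (at_right t)) \<and> (\<forall>t>0. \<exists>l. (f \<longlongrightarrow> l) (at_left t))"

definition natural_filtration ::
  "'w measure \<Rightarrow> (real \<Rightarrow> 'w \<Rightarrow> real) \<Rightarrow> real \<Rightarrow> 'w measure" where
  "natural_filtration M X s =
     sigma (space M) (\<Union>u\<in>{0..s}. {X u -` B \<inter> space M | B. B \<in> sets borel})"

definition realization ::
  "real set \<Rightarrow> (real \<Rightarrow> real \<Rightarrow> real measure) \<Rightarrow> (real \<Rightarrow> 'w measure) \<Rightarrow>
   (real \<Rightarrow> 'w \<Rightarrow> real) \<Rightarrow> bool" where
  "realization E K Pr X \<longleftrightarrow>
     (\<forall>x\<in>E. \<forall>y\<in>E. sets (Pr x) = sets (Pr y)) \<and>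
     (\<forall>x\<in>E. prob_space (Pr x) \<and>
        (\<forall>t\<ge>0. X t \<in> Pr x \<rightarrow>\<^sub>M borel_on E) \<and>
        (\<forall>w\<in>space (Pr x). cadlag (\<lambda>t. X t w)) \<and>
        (AE w in Pr x. X 0 w = x) \<and>
        (\<forall>s\<ge>0. \<forall>t\<ge>0. \<forall>f. bounded_borel E f \<longrightarrow>
           (AE w in Pr x.
              real_cond_exp (Pr x) (natural_filtration (Pr x) X s) (\<lambda>w. f (X (s + t) w)) w =
              real_op K t f (X s w))))"

section \<open>The Ornstein-Uhlenbeck semigroup\<close>

definition e_chi :: "real \<Rightarrow> real \<Rightarrow> real" where
  "e_chi chi t = (exp (chi * t) - 1) / chi"

text \<open>The value type is left polymorphic so that \<open>ou_op\<close> applies both to \<open>real_op K\<close> and to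
  \<open>nn_op K\<close>.\<close>

definition ou_op :: "real \<Rightarrow> real \<Rightarrow> (real \<Rightarrow> (real \<Rightarrow> 'a) \<Rightarrow> real \<Rightarrow> 'a) \<Rightarrow>
    real \<Rightarrow> (real \<Rightarrow> 'a) \<Rightarrow> real \<Rightarrow> 'a" where
  "ou_op lam chi P t f x = P (e_chi chi t) (dil (exp (- lam * t)) f) x"

definition ou_process :: "real \<Rightarrow> real \<Rightarrow> (real \<Rightarrow> 'w \<Rightarrow> real) \<Rightarrow> real \<Rightarrow> 'w \<Rightarrow> real" where
  "ou_process lam chi X t w = exp (- lam * t) * X (e_chi chi t) w"

text \<open>The law \<open>P\<^sub>0(X\<^sub>1 \<in> dx)\<close> becomes invariant for \<open>U\<close> only after the change of scale
  \<open>x \<mapsto> chi powr (- 1 / \<alpha>) * x\<close>, that is, as the law of \<open>X\<close> at time \<open>1 / chi\<close> under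
  \<open>P\<^sub>0\<close>: for Brownian motion (\<open>\<alpha> = 2\<close>) the invariant law is centred Gaussian with variance
  \<open>1 / chi\<close>. Multiplying the measure itself by \<open>chi\<close> would not even give total mass 1.\<close>

definition invariant_prob ::
  "real set \<Rightarrow> (real \<Rightarrow> (real \<Rightarrow> real) \<Rightarrow> real \<Rightarrow> real) \<Rightarrow> real measure \<Rightarrow> bool" where
  "invariant_prob E S m \<longleftrightarrow> prob_space m \<and> sets m = sets (borel_on E) \<and>
     (\<forall>t\<ge>0. \<forall>f. bounded_borel E f \<longrightarrow> (\<integral>x. S t f x \<partial>m) = (\<integral>x. f x \<partial>m))"

text \<open>Positive recurrence in the topological form of Harris' condition: there is an invariant
  probability measure \<open>m\<close>, and from every starting point the process almost surely spends an infinite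
  amount of time in each (relatively) open set charged by \<open>m\<close>. Asking this of all Borel sets would
  exclude degenerate but admissible processes: for \<open>\<xi>\<^sub>t = b t\<close> with \<open>b > 0\<close> the process
  \<open>U\<close> is deterministic and \<open>m\<close> is a Dirac mass at a point to which \<open>U\<close> converges without reaching it.\<close>

definition positively_recurrent ::
  "real set \<Rightarrow> (real \<Rightarrow> (real \<Rightarrow> real) \<Rightarrow> real \<Rightarrow> real) \<Rightarrow> (real \<Rightarrow> 'w measure) \<Rightarrow>
   (real \<Rightarrow> 'w \<Rightarrow> real) \<Rightarrow> bool" where
  "positively_recurrent E S Pr U \<longleftrightarrow>
     (\<exists>m. invariant_prob E S m \<and>
        (\<forall>x\<in>E. \<forall>V. openin (top_of_set E) V \<and> emeasure m V > 0 \<longrightarrow>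
           (AE w in Pr x.
              (\<integral>\<^sup>+t. indicator {t. t \<ge> 0 \<and> U t w \<in> V} t \<partial>lborel) = \<infinity>)))"

section \<open>Semi-stable processes\<close>

text \<open>\<open>\<xi>\<close> is started at \<open>0\<close>.\<close>

definition levy_process :: "'v measure \<Rightarrow> (real \<Rightarrow> 'v \<Rightarrow> real) \<Rightarrow> bool" where
  "levy_process N \<xi> \<longleftrightarrow> prob_space N \<and>
     (\<forall>t\<ge>0. \<xi> t \<in> borel_measurable N) \<and>
     (\<forall>w\<in>space N. \<xi> 0 w = 0 \<and> cadlag (\<lambda>t. \<xi> t w)) \<and>
     (\<forall>s\<ge>0. \<forall>t\<ge>0. distr N borel (\<lambda>w. \<xi> (s + t) w - \<xi> s w) = distr N borel (\<xi> t)) \<and>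
     (\<forall>n. \<forall>\<tau>::nat \<Rightarrow> real. \<tau> 0 \<ge> 0 \<and> mono \<tau> \<longrightarrow>
        prob_space.indep_vars N (\<lambda>_. borel) (\<lambda>i w. \<xi> (\<tau> (Suc i)) w - \<xi> (\<tau> i) w) {..<n})"

definition arithmetic :: "'v measure \<Rightarrow> (real \<Rightarrow> 'v \<Rightarrow> real) \<Rightarrow> bool" where
  "arithmetic N \<xi> \<longleftrightarrow> (\<exists>r>0. \<forall>t\<ge>0. AE w in N. \<exists>k::int. \<xi> t w = r * of_int k)"

text \<open>Left limits, with the convention \<open>f (0-) = f 0\<close>.\<close>

definition left_lim :: "(real \<Rightarrow> real) \<Rightarrow> real \<Rightarrow> real" where
  "left_lim f t = (if t \<le> 0 then f 0 else Lim (at_left t) f)"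

definition spectrally_negative :: "'v measure \<Rightarrow> (real \<Rightarrow> 'v \<Rightarrow> real) \<Rightarrow> bool" where
  "spectrally_negative N \<xi> \<longleftrightarrow> (AE w in N. \<forall>t>0. \<xi> t w \<le> left_lim (\<lambda>s. \<xi> s w) t)"

text \<open>The Lamperti transform of the L\'evy process \<open>ln x + \<xi>\<close>, started at \<open>x > 0\<close>, and sent
  to \<open>0\<close> from the lifetime on (i.e. once the set defining the time change \<open>A\<^sub>t\<close> is empty).\<close>

definition lamperti ::
  "real \<Rightarrow> (real \<Rightarrow> 'v \<Rightarrow> real) \<Rightarrow> real \<Rightarrow> real \<Rightarrow> 'v \<Rightarrow> real" where
  "lamperti \<alpha> \<xi> x t w =
     (let Y = (\<lambda>s. ln x + \<xi> s w);
          A = {u. u \<ge> 0 \<and> ennreal t < (\<integral>\<^sup>+s\<in>{0..u}. ennreal (exp (\<alpha> * Y s)) \<partial>lborel)}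
      in if A = {} then 0 else exp (Y (Inf A)))"

definition same_fdd ::
  "'w measure \<Rightarrow> (real \<Rightarrow> 'w \<Rightarrow> real) \<Rightarrow> 'v measure \<Rightarrow> (real \<Rightarrow> 'v \<Rightarrow> real) \<Rightarrow> bool" where
  "same_fdd M X N Y \<longleftrightarrow>
     (\<forall>J\<subseteq>{0..}. finite J \<longrightarrow>
        distr M (PiM J (\<lambda>_. borel)) (\<lambda>w. \<lambda>j\<in>J. X j w) =
        distr N (PiM J (\<lambda>_. borel)) (\<lambda>w. \<lambda>j\<in>J. Y j w))"

text \<open>The infinite-lifetime case. Convergence of the finite-dimensional distributions to those of
  \<open>Pr 0\<close> is tested on products of bounded continuous functions.\<close>

definition semi_stable_entrance ::
  "real \<Rightarrow> (real \<Rightarrow> 'w measure) \<Rightarrow> (real \<Rightarrow> 'w \<Rightarrow> real) \<Rightarrow> 'v measure \<Rightarrow>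
   (real \<Rightarrow> 'v \<Rightarrow> real) \<Rightarrow> bool" where
  "semi_stable_entrance \<alpha> Pr X N \<xi> \<longleftrightarrow>
     (\<forall>x>0. same_fdd (Pr x) X N (lamperti \<alpha> \<xi> x)) \<and>
     (\<forall>J\<subseteq>{0..}. finite J \<longrightarrow>
        (\<forall>f::real \<Rightarrow> real \<Rightarrow> real.
           (\<forall>j\<in>J. continuous_on UNIV (f j) \<and> bounded (range (f j))) \<longrightarrow>
           ((\<lambda>x. \<integral>w. (\<Prod>j\<in>J. f j (X j w)) \<partial>Pr x) \<longlongrightarrow>
             (\<integral>w. (\<Prod>j\<in>J. f j (X j w)) \<partial>Pr 0)) (at_right 0)))"

definition T0 :: "(real \<Rightarrow> 'w \<Rightarrow> real) \<Rightarrow> 'w \<Rightarrow> ereal" where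
  "T0 X w = Inf (ereal ` {u. u \<ge> 0 \<and> left_lim (\<lambda>s. X s w) u = 0 \<and> X u w = 0})"

text \<open>\<open>E[e\<^bsup>\<theta>\<xi>\<^sub>1\<^esup>] = 1\<close> has a unique positive solution, namely \<open>\<theta>\<close>.\<close>

definition cramer_exponent :: "'v measure \<Rightarrow> (real \<Rightarrow> 'v \<Rightarrow> real) \<Rightarrow> real \<Rightarrow> bool" where
  "cramer_exponent N \<xi> \<theta> \<longleftrightarrow>
     (\<forall>\<theta>'>0. (\<integral>\<^sup>+w. ennreal (exp (\<theta>' * \<xi> 1 w)) \<partial>N) = 1 \<longleftrightarrow> \<theta>' = \<theta>) \<and> \<theta> > 0"

text \<open>The minimal process is recovered by absorbing \<open>X\<close> at \<open>0\<close> at time \<open>T0\<close>; the variable \<open>T\<close> is a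
  measurable version of \<open>T0\<close>, whose measurability is otherwise not guaranteed since \<open>Pr x\<close> need not
  be complete. Hitting and leaving \<open>0\<close> continuously means that almost surely no jump of \<open>X\<close> ends
  or starts at \<open>0\<close>. Recurrence of \<open>0\<close> as a non-absorbing state is the last conjunct. The strong Markov
  property and self-similarity are part of the assumptions under which this predicate is used.\<close>

definition recurrent_extension ::
  "real \<Rightarrow> (real \<Rightarrow> 'w measure) \<Rightarrow> (real \<Rightarrow> 'w \<Rightarrow> real) \<Rightarrow> 'v measure \<Rightarrow>
   (real \<Rightarrow> 'v \<Rightarrow> real) \<Rightarrow> bool" where
  "recurrent_extension \<alpha> Pr X N \<xi> \<longleftrightarrow>
     (\<forall>x>0. \<exists>T. T \<in> borel_measurable (Pr x) \<and> (AE w in Pr x. T w = T0 X w) \<and>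
        same_fdd (Pr x) (\<lambda>t w. if ereal t < T w then X t w else 0) N (lamperti \<alpha> \<xi> x)) \<and>
     (\<forall>x\<ge>0. AE w in Pr x. \<forall>t>0. left_lim (\<lambda>s. X s w) t = 0 \<longleftrightarrow> X t w = 0) \<and>
     (\<forall>x\<ge>0. AE w in Pr x. \<forall>s\<ge>0. (\<exists>t\<ge>s. X t w = 0) \<and> (\<exists>t\<ge>s. X t w \<noteq> 0))"

definition H0 ::
  "real set \<Rightarrow> real \<Rightarrow> (real \<Rightarrow> 'w measure) \<Rightarrow> (real \<Rightarrow> 'w \<Rightarrow> real) \<Rightarrow> 'v measure \<Rightarrow>
   (real \<Rightarrow> 'v \<Rightarrow> real) \<Rightarrow> bool" where
  "H0 E \<alpha> Pr X N \<xi> \<longleftrightarrow>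
     E = {0..} \<and> levy_process N \<xi> \<and> \<not> arithmetic N \<xi> \<and> integrable N (\<xi> 1) \<and>
     (let b = (\<integral>w. \<xi> 1 w \<partial>N) in
        ((b > 0 \<or> b = 0 \<and> spectrally_negative N \<xi>) \<and> semi_stable_entrance \<alpha> Pr X N \<xi>) \<or>
        (b < 0 \<and> (\<exists>\<theta><\<alpha>. cramer_exponent N \<xi> \<theta>) \<and> recurrent_extension \<alpha> Pr X N \<xi>))"

section \<open>Excessive and invariant functions, and the Gamma mixture\<close>

definition excessive ::
  "real set \<Rightarrow> (real \<Rightarrow> (real \<Rightarrow> ennreal) \<Rightarrow> real \<Rightarrow> ennreal) \<Rightarrow> real \<Rightarrow> (real \<Rightarrow> ennreal) \<Rightarrow> bool" where
  "excessive E S r h \<longleftrightarrow> h \<in> borel_measurable (borel_on E) \<and>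
     (\<forall>x\<in>E. (\<forall>t>0. ennreal (exp (- r * t)) * S t h x \<le> h x) \<and>
            ((\<lambda>t. ennreal (exp (- r * t)) * S t h x) \<longlongrightarrow> h x) (at_right 0))"

definition invariant ::
  "real set \<Rightarrow> (real \<Rightarrow> (real \<Rightarrow> ennreal) \<Rightarrow> real \<Rightarrow> ennreal) \<Rightarrow> real \<Rightarrow> (real \<Rightarrow> ennreal) \<Rightarrow> bool" where
  "invariant E S r h \<longleftrightarrow> h \<in> borel_measurable (borel_on E) \<and>
     (\<forall>x\<in>E. (\<forall>t>0. ennreal (exp (- r * t)) * S t h x = h x) \<and>
            ((\<lambda>t. ennreal (exp (- r * t)) * S t h x) \<longlongrightarrow> h x) (at_right 0))"

definition gamma_law :: "real \<Rightarrow> real measure" where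
  "gamma_law q = density (restrict_space lborel {0<..})
                   (\<lambda>r. ennreal (exp (- r) * r powr (q - 1) / Gamma q))"

definition L1 :: "real measure \<Rightarrow> (real \<Rightarrow> ennreal) \<Rightarrow> bool" where
  "L1 M h \<longleftrightarrow> h \<in> borel_measurable M \<and> (\<integral>\<^sup>+r. h r \<partial>M) < \<infinity>"

definition gamma_mix :: "real \<Rightarrow> real \<Rightarrow> (real \<Rightarrow> ennreal) \<Rightarrow> real \<Rightarrow> real \<Rightarrow> ennreal" where
  "gamma_mix \<alpha> chi h q x =
     ennreal (chi powr (q / chi)) *
     (\<integral>\<^sup>+r. h ((chi * r) powr (1 / \<alpha>) * x) \<partial>gamma_law (q / chi))"

end

theory Submission
  imports Defs
begin

text \<open>By self-similarity the law of \<open>U t\<close> started at \<open>x\<close> is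
  \<open>K ((1 - exp (- chi * t)) / chi) (exp (- lam * t) * x)\<close>, and by the Feller property it converges
  to \<open>K (1 / chi) 0\<close> from every starting point. This identifies the invariant law, and with the
  Markov property it makes \<open>f (U t)\<close> asymptotically independent of the past. If \<open>U\<close> spent a bounded
  amount of time in an open set charged by the invariant law on an event of positive probability,
  approximating this event by one from the past would contradict this mixing, so \<open>U\<close> is recurrent.

  For the Gamma mixture, self-similarity and Fubini's theorem express
  \<open>exp (- q * t) * Q\<^sub>t\<close> applied to the mixture of \<open>h\<close> as the mixture of the quantities
  \<open>exp (- s) * P\<^sub>s h\<close> with \<open>s = u * (exp (chi * t) - 1)\<close>, where \<open>u\<close> is the Gamma variable.\<close>

section \<open>Mixtures under the Gamma law\<close>

text \<open>The parameter \<open>q / chi\<close> of the Gamma law is forced. Scaling the variable by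
  \<open>exp (- chi * t)\<close> absorbs the dilation \<open>exp (- lam * t)\<close> because
  \<open>chi = \<alpha> * lam\<close>; it produces the factor \<open>exp (q * t)\<close>, which
  cancels the discount at rate \<open>q\<close>, and leaves an exponential tilt that is exactly the
  discount at rate 1 at the new time. For recurrence, two obstacles shape the argument. The Feller
  property controls only functions in \<open>C0 E\<close>, so an open set is replaced by a
  continuous function that is positive exactly on it. And the event of bounded total occupation is
  not decided at any finite time, while the Markov property speaks of past events only. It is,
  however, a decreasing limit of events decided at time \<open>n\<close>; this is why occupation
  times must be measurable for the natural filtration and not merely for \<open>Pr x\<close>. No
  stopping times enter: on the bad event the expected rate of occupation is eventually bounded
  below, and integrating this rate over deterministic times exceeds any bound.\<close>

lemma nn_integral_gamma_law:
  assumes F: "F \<in> borel_measurable (restrict_space borel {0<..})"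
  shows "(\<integral>\<^sup>+r. F r \<partial>gamma_law p) =
    (\<integral>\<^sup>+r. ennreal (exp (- r) * r powr (p - 1) / Gamma p) * F r * indicator {0<..} r \<partial>lborel)"
proof -
  have "F \<in> borel_measurable (restrict_space lborel {0<..})"
    using F by (simp add: measurable_cong_sets[OF sets_restrict_space_cong[OF sets_lborel] refl])
  then show ?thesis
    unfolding gamma_law_def
    by (subst nn_integral_density) (auto simp: nn_integral_restrict_space intro!: measurable_restrict_space1)
qed

text \<open>The density of \<open>a\<close> times a Gamma variable is \<open>a powr - p\<close>
  times the Gamma density tilted by \<open>exp (- u * (1 / a - 1))\<close>, by the substitution
  \<open>u = a * r\<close>.\<close>

lemma nn_integral_gamma_law_scale:
  assumes F: "F \<in> borel_measurable (restrict_space borel {0<..})" and p: "p > 0" and a: "a > 0"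
  shows "(\<integral>\<^sup>+r. F (a * r) \<partial>gamma_law p) =
    ennreal (a powr - p) * (\<integral>\<^sup>+u. ennreal (exp (- u * (1 / a - 1))) * F u \<partial>gamma_law p)"
proof -
  \<comment> \<open>Extending \<open>F\<close> by 0 gives a function measurable on the whole line,
    to which the affine substitution for \<open>lborel\<close> applies.\<close>
  define G where "G r = (if r > 0 then F r else 0)" for r
  have [measurable]: "G \<in> borel_measurable borel"
    using F unfolding G_def by (subst (asm) measurable_restrict_space_iff[where c=0]) auto
  define d where "d r = exp (- r) * r powr (p - 1) / Gamma p" for r :: real
  have [measurable]: "d \<in> borel_measurable borel" unfolding d_def by measurable
  have Gp: "Gamma p > 0" using p by (rule Gamma_real_pos)
  have "(\<integral>\<^sup>+r. F (a * r) \<partial>gamma_law p) = (\<integral>\<^sup>+r. ennreal (d r) * F (a * r) * indicator {0<..} r \<partial>lborel)"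
    unfolding d_def
    by (rule nn_integral_gamma_law, rule measurable_compose[OF _ F],
        intro measurable_restrict_space2 measurable_restrict_space1)
      (use a in \<open>auto simp: space_restrict_space\<close>)
  also have "\<dots> = (\<integral>\<^sup>+r. ennreal (d r) * G (a * r) * indicator {0<..} r \<partial>lborel)"
    using a by (intro nn_integral_cong) (auto simp: G_def indicator_def)
  also have "\<dots> = ennreal (1 / a) * (\<integral>\<^sup>+u. ennreal (d (u / a)) * G u * indicator {0<..} (u / a) \<partial>lborel)"
    using a by (subst nn_integral_real_affine[where c = "1 / a" and t = 0]) auto
  also have "\<dots> = (\<integral>\<^sup>+u. ennreal (1 / a) * (ennreal (d (u / a)) * G u * indicator {0<..} (u / a)) \<partial>lborel)"
    by (rule nn_integral_cmult[symmetric]) auto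
  also have "\<dots> = (\<integral>\<^sup>+u. ennreal (a powr - p) *
      (ennreal (d u) * (ennreal (exp (- u * (1 / a - 1))) * F u) * indicator {0<..} u) \<partial>lborel)"
  proof (intro nn_integral_cong)
    fix u :: real
    show "ennreal (1 / a) * (ennreal (d (u / a)) * G u * indicator {0<..} (u / a)) =
      ennreal (a powr - p) * (ennreal (d u) * (ennreal (exp (- u * (1 / a - 1))) * F u) * indicator {0<..} u)"
    proof (cases "u > 0")
      case True
      have "1 / a * d (u / a) = a powr - p * (d u * exp (- u * (1 / a - 1)))"
      proof -
        have e: "exp (- u) * exp (- u * (1 / a - 1)) = exp (- (u / a))"
          by (subst exp_add[symmetric]) (simp add: algebra_simps)
        have "1 / a * d (u / a) = exp (- (u / a)) * (u powr (p - 1) * (1 / a / a powr (p - 1))) / Gamma p"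
          using a True by (simp add: d_def powr_divide)
        also have "1 / a / a powr (p - 1) = a powr - p"
          using a by (simp add: powr_diff powr_minus field_simps)
        finally show ?thesis unfolding d_def e[symmetric] by simp
      qed
      moreover have d: "0 \<le> d u" "0 \<le> d (u / a)" using Gp by (auto simp: d_def)
      ultimately have "ennreal (1 / a) * ennreal (d (u / a)) =
          ennreal (a powr - p) * (ennreal (d u) * ennreal (exp (- u * (1 / a - 1))))"
        using a by (simp add: ennreal_mult[symmetric] del: times_divide_eq_left)
      then have "(ennreal (1 / a) * ennreal (d (u / a))) * F u =
          (ennreal (a powr - p) * (ennreal (d u) * ennreal (exp (- u * (1 / a - 1))))) * F u"
        by (rule arg_cong)
      then show ?thesis
        using True a by (simp only: G_def mult.assoc) (simp add: mult.assoc)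
    qed (use a in \<open>auto simp: G_def indicator_def field_simps\<close>)
  qed
  also have "\<dots> = ennreal (a powr - p) *
      (\<integral>\<^sup>+u. ennreal (d u) * (ennreal (exp (- u * (1 / a - 1))) * F u) * indicator {0<..} u \<partial>lborel)"
  proof -
    have "(\<lambda>u. ennreal (d u) * (ennreal (exp (- u * (1 / a - 1))) * F u) * indicator {0<..} u) =
      (\<lambda>u. ennreal (d u) * (ennreal (exp (- u * (1 / a - 1))) * G u))"
      by (auto simp: G_def indicator_def fun_eq_iff)
    then show ?thesis by (subst nn_integral_cmult) auto
  qed
  also have "\<dots> = ennreal (a powr - p) * (\<integral>\<^sup>+u. ennreal (exp (- u * (1 / a - 1))) * F u \<partial>gamma_law p)"
    unfolding d_def
    by (rule arg_cong[OF nn_integral_gamma_law[symmetric]])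
      (intro borel_measurable_times_ennreal F, simp add: measurable_restrict_space1)
  finally show ?thesis .
qed

lemma sigma_finite_gamma_law: "sigma_finite_measure (gamma_law p)"
proof -
  have "sigma_finite_measure (restrict_space lborel {0::real<..})"
    by (rule sigma_finite_measure_restrict_space[OF lborel.sigma_finite_measure_axioms]) simp
  moreover have "(\<lambda>r. ennreal (exp (- r) * r powr (p - 1) / Gamma p)) \<in>
      borel_measurable (restrict_space lborel {0::real<..})"
    by (rule measurable_restrict_space1) measurable
  ultimately show ?thesis unfolding gamma_law_def
    by (subst sigma_finite_measure.sigma_finite_iff_density_finite) auto
qed

lemma sets_gamma_law: "sets (gamma_law p) = sets (restrict_space borel {0<..})"
  unfolding gamma_law_def sets_density by (rule sets_restrict_space_cong) simp

section \<open>Scaling of the kernels and its effect on Gamma mixtures\<close>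

locale self_similar_feller =
  fixes \<alpha> :: real and E :: "real set" and K :: "real \<Rightarrow> real \<Rightarrow> real measure"
  assumes alpha_pos: "\<alpha> > 0" and E_cases: "E \<in> {UNIV, {0<..}, {0..}}"
    and feller: "feller_semigroup E K" and self_sim: "self_similar \<alpha> E K"
begin

lemma E_scale: "c > 0 \<Longrightarrow> x \<in> E \<Longrightarrow> c * x \<in> E"
  using E_cases by auto

lemma space_borel_on: "space (borel_on E) = E"
  by (simp add: space_restrict_space)

lemma measurable_scale: "c > 0 \<Longrightarrow> (*) c \<in> borel_on E \<rightarrow>\<^sub>M borel_on E"
  by (intro measurable_restrict_space2 measurable_restrict_space1)
    (auto simp: space_borel_on intro: E_scale)

lemma kernel_measurable: "t \<ge> 0 \<Longrightarrow> K t \<in> borel_on E \<rightarrow>\<^sub>M subprob_algebra (borel_on E)"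
  using feller by (auto simp: feller_semigroup_def)

lemma kernel_zero: "x \<in> E \<Longrightarrow> K 0 x = return (borel_on E) x"
  using feller by (auto simp: feller_semigroup_def)

lemma kernel_add: "s \<ge> 0 \<Longrightarrow> t \<ge> 0 \<Longrightarrow> x \<in> E \<Longrightarrow> K (s + t) x = K s x \<bind> K t"
  using feller by (auto simp: feller_semigroup_def)

lemma sets_K: "t \<ge> 0 \<Longrightarrow> x \<in> E \<Longrightarrow> sets (K t x) = sets (borel_on E)"
  using subprob_measurableD(2)[OF kernel_measurable] by (simp add: space_borel_on)

lemma space_K: "t \<ge> 0 \<Longrightarrow> x \<in> E \<Longrightarrow> space (K t x) = E"
  using sets_eq_imp_space_eq[OF sets_K] by (simp add: space_borel_on)

lemma subprob_K: "t \<ge> 0 \<Longrightarrow> x \<in> E \<Longrightarrow> subprob_space (K t x)"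
  using subprob_space_kernel[OF kernel_measurable] by (simp add: space_borel_on)

text \<open>Self-similarity is assumed for bounded functions under the Bochner integral. Testing it
  on indicators turns it into an identity of measures, which then also applies to
  \<open>ennreal\<close>-valued functions.\<close>

lemma kernel_scale:
  assumes "c > 0" "t \<ge> 0" "x \<in> E"
  shows "K (c powr \<alpha> * t) (c * x) = distr (K t x) (borel_on E) ((*) c)"
proof (rule measure_eqI)
  have t': "c powr \<alpha> * t \<ge> 0" and x': "c * x \<in> E"
    using assms E_scale by auto
  show "sets (K (c powr \<alpha> * t) (c * x)) = sets (distr (K t x) (borel_on E) ((*) c))"
    using sets_K[OF t' x'] by simp
  fix A assume "A \<in> sets (K (c powr \<alpha> * t) (c * x))"
  then have A: "A \<in> sets (borel_on E)" using sets_K[OF t' x'] by simp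
  have m: "(*) c \<in> K t x \<rightarrow>\<^sub>M borel_on E"
    using measurable_scale[OF assms(1)] by (simp add: measurable_cong_sets[OF sets_K[OF assms(2,3)] refl])
  have bb: "bounded_borel E (indicator A)"
    unfolding bounded_borel_def using A by (auto intro!: boundedI[where B=1] simp: indicator_def)
  interpret A: subprob_space "K (c powr \<alpha> * t) (c * x)" by (rule subprob_K[OF t' x'])
  interpret B: subprob_space "K t x" by (rule subprob_K[OF assms(2,3)])
  have pre: "(*) c -` A \<inter> space (K t x) \<in> sets (K t x)"
    using measurable_sets[OF m A] .
  have "measure (K (c powr \<alpha> * t) (c * x)) A = real_op K (c powr \<alpha> * t) (indicator A) (c * x)"
    unfolding real_op_def using A sets_K[OF t' x'] sets.sets_into_space[OF A]
    by (simp add: space_K[OF t' x'] space_borel_on Int_absorb1 Int_absorb2)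
  also have "\<dots> = real_op K t (dil c (indicator A)) x"
    using self_sim assms bb by (simp add: self_similar_def)
  also have "\<dots> = (\<integral>y. indicator ((*) c -` A \<inter> space (K t x)) y \<partial>K t x)"
    unfolding real_op_def dil_def by (intro Bochner_Integration.integral_cong) (auto simp: indicator_def)
  also have "\<dots> = measure (K t x) ((*) c -` A \<inter> space (K t x))"
    using pre by simp
  finally show "emeasure (K (c powr \<alpha> * t) (c * x)) A = emeasure (distr (K t x) (borel_on E) ((*) c)) A"
    by (simp add: emeasure_distr[OF m A] A.emeasure_eq_measure B.emeasure_eq_measure)
qed

lemma nn_op_dil:
  assumes "c > 0" "t \<ge> 0" "x \<in> E" "h \<in> borel_measurable (borel_on E)"
  shows "nn_op K t (dil c h) x = nn_op K (c powr \<alpha> * t) h (c * x)"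
proof -
  have m: "(*) c \<in> K t x \<rightarrow>\<^sub>M borel_on E"
    using measurable_scale[OF assms(1)] by (simp add: measurable_cong_sets[OF sets_K[OF assms(2,3)] refl])
  show ?thesis
    unfolding nn_op_def dil_def kernel_scale[OF assms(1-3)]
    by (subst nn_integral_distr[OF m]) (use assms(4) in auto)
qed

text \<open>The parameter \<open>u\<close> is kept in \<open>{0<..}\<close>: there the dilation
  factor is positive, so the product stays in \<open>E\<close> for each of the three state
  spaces.\<close>

lemma measurable_gamma_scale:
  assumes "h \<in> borel_measurable (borel_on E)" and chi: "chi > 0"
  shows "(\<lambda>(u, y). h ((chi * u) powr (1 / \<alpha>) * y)) \<in>
    borel_measurable (restrict_space borel {0<..} \<Otimes>\<^sub>M borel_on E)"
proof -
  have [measurable]: "fst \<in> restrict_space borel {0<..} \<Otimes>\<^sub>M borel_on E \<rightarrow>\<^sub>M (borel :: real measure)"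
    by (rule measurable_compose[OF measurable_fst]) (simp add: measurable_restrict_space1)
  have [measurable]: "snd \<in> restrict_space borel {0<..} \<Otimes>\<^sub>M borel_on E \<rightarrow>\<^sub>M (borel :: real measure)"
    by (rule measurable_compose[OF measurable_snd]) (simp add: measurable_restrict_space1)
  have "(\<lambda>p. (chi * fst p) powr (1 / \<alpha>) * snd p) \<in>
    restrict_space borel {0<..} \<Otimes>\<^sub>M borel_on E \<rightarrow>\<^sub>M borel_on E"
    by (intro measurable_restrict_space2)
      (use chi in \<open>auto simp: space_pair_measure space_restrict_space intro!: E_scale\<close>)
  from measurable_compose[OF this assms(1)] show ?thesis
    by (simp add: case_prod_beta')
qed

lemma gamma_mix_measurable:
  assumes h: "h \<in> borel_measurable (borel_on E)" and chi: "chi > 0"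
  shows "gamma_mix \<alpha> chi h q \<in> borel_measurable (borel_on E)"
proof -
  interpret sigma_finite_measure "gamma_law (q / chi)" by (rule sigma_finite_gamma_law)
  have "(\<lambda>(x, r). h ((chi * r) powr (1 / \<alpha>) * x)) \<in> borel_measurable (borel_on E \<Otimes>\<^sub>M gamma_law (q / chi))"
    using measurable_pair_swap[OF measurable_gamma_scale[OF h chi]]
    by (simp add: measurable_cong_sets[OF sets_pair_measure_cong[OF refl sets_gamma_law] refl] case_prod_beta')
  from borel_measurable_nn_integral[OF this] show ?thesis
    unfolding gamma_mix_def by auto
qed

text \<open>Fubini moves the kernel inside the Gamma integral, and the change of variable from
  \<open>r\<close> to \<open>u = a * r\<close> absorbs the dilation of \<open>Q\<^sub>t\<close>.
  Self-similarity then trades the factor \<open>(chi * u) powr (1 / \<alpha>)\<close> inside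
  \<open>h\<close> for a new starting point and multiplies the time \<open>e_chi chi t\<close> by
  \<open>chi * u\<close>. The second conclusion is the measurability required by Fatou's lemma in
  the excessive case.\<close>

lemma ou_op_gamma_mix:
  assumes h: "h \<in> borel_measurable (borel_on E)" and lam: "lam > 0" and chi: "chi = \<alpha> * lam"
    and q: "q > 0" and t: "t \<ge> 0" and x: "x \<in> E"
  shows "ennreal (exp (- q * t)) * ou_op lam chi (nn_op K) t (gamma_mix \<alpha> chi h q) x =
    ennreal (chi powr (q / chi)) *
      (\<integral>\<^sup>+u. ennreal (exp (- u * (exp (chi * t) - 1))) *
        nn_op K (u * (exp (chi * t) - 1)) h ((chi * u) powr (1 / \<alpha>) * x) \<partial>gamma_law (q / chi))"
    and "(\<lambda>u. ennreal (exp (- u * (exp (chi * t) - 1))) *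
        nn_op K (u * (exp (chi * t) - 1)) h ((chi * u) powr (1 / \<alpha>) * x)) \<in> borel_measurable (gamma_law (q / chi))"
proof -
  have chi_pos: "chi > 0" using alpha_pos lam chi by simp
  define s where "s = e_chi chi t"
  have s: "s \<ge> 0" using chi_pos t by (simp add: s_def e_chi_def)
  \<comment> \<open>The scaling of the Gamma variable whose power \<open>1 / \<alpha>\<close> equals
    \<open>exp (- lam * t)\<close>.\<close>
  define a where "a = exp (- chi * t)"
  define F where "F u = (\<integral>\<^sup>+y. h ((chi * u) powr (1 / \<alpha>) * y) \<partial>K s x)" for u
  interpret K: subprob_space "K s x" by (rule subprob_K[OF s x])
  interpret G: sigma_finite_measure "gamma_law (q / chi)" by (rule sigma_finite_gamma_law)
  interpret P: pair_sigma_finite "gamma_law (q / chi)" "K s x" ..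
  have hm: "(\<lambda>(u, y). h ((chi * u) powr (1 / \<alpha>) * y)) \<in>
    borel_measurable (restrict_space borel {0<..} \<Otimes>\<^sub>M K s x)"
    using measurable_gamma_scale[OF h chi_pos]
    by (simp add: measurable_cong_sets[OF sets_pair_measure_cong[OF refl sets_K[OF s x]] refl])
  have F: "F \<in> borel_measurable (restrict_space borel {0<..})"
    using K.borel_measurable_nn_integral[OF hm] by (simp add: F_def[abs_def])
  have F_eq: "F u = nn_op K (u * (exp (chi * t) - 1)) h ((chi * u) powr (1 / \<alpha>) * x)" if "u > 0" for u
  proof -
    have "F u = nn_op K s (dil ((chi * u) powr (1 / \<alpha>)) h) x"
      by (simp add: F_def nn_op_def dil_def)
    also have "\<dots> = nn_op K (((chi * u) powr (1 / \<alpha>)) powr \<alpha> * s) h ((chi * u) powr (1 / \<alpha>) * x)"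
      using that chi_pos by (intro nn_op_dil s x h) auto
    also have "((chi * u) powr (1 / \<alpha>)) powr \<alpha> * s = u * (exp (chi * t) - 1)"
      using that chi_pos alpha_pos by (simp add: powr_powr s_def e_chi_def)
    finally show ?thesis .
  qed
  have a_scale: "(chi * r) powr (1 / \<alpha>) * exp (- lam * t) = (chi * (a * r)) powr (1 / \<alpha>)" if "r > 0" for r
  proof -
    have "a powr (1 / \<alpha>) = exp (- lam * t)"
      using alpha_pos by (simp add: a_def powr_def chi)
    then show ?thesis using that chi_pos by (simp add: powr_mult a_def mult_ac)
  qed
  have space_g: "space (gamma_law (q / chi)) = {0<..}"
    using sets_eq_imp_space_eq[OF sets_gamma_law] by (simp add: space_restrict_space)
  have hm': "(\<lambda>(u, y). h ((chi * u) powr (1 / \<alpha>) * y)) \<in>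
    borel_measurable (gamma_law (q / chi) \<Otimes>\<^sub>M K s x)"
    using hm by (simp add: measurable_cong_sets[OF sets_pair_measure_cong[OF sets_gamma_law refl] refl])
  have ax: "(\<lambda>u. a * u) \<in> gamma_law (q / chi) \<rightarrow>\<^sub>M gamma_law (q / chi)"
    unfolding measurable_cong_sets[OF sets_gamma_law sets_gamma_law]
    by (intro measurable_restrict_space2 measurable_restrict_space1) (auto simp: a_def space_restrict_space)
  have hm_a: "(\<lambda>(u, y). h ((chi * (a * u)) powr (1 / \<alpha>) * y)) \<in>
    borel_measurable (gamma_law (q / chi) \<Otimes>\<^sub>M K s x)"
    using measurable_compose[OF measurable_Pair[OF measurable_compose[OF measurable_fst ax] measurable_snd] hm']
    by (simp add: case_prod_beta')
  have gm: "(\<lambda>y. \<integral>\<^sup>+r. h ((chi * (a * r)) powr (1 / \<alpha>) * y) \<partial>gamma_law (q / chi)) \<in> borel_measurable (K s x)"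
    using G.borel_measurable_nn_integral[OF measurable_pair_swap[OF hm_a]] by (simp add: case_prod_beta')
  have "ou_op lam chi (nn_op K) t (gamma_mix \<alpha> chi h q) x =
    (\<integral>\<^sup>+y. ennreal (chi powr (q / chi)) *
      (\<integral>\<^sup>+r. h ((chi * r) powr (1 / \<alpha>) * (exp (- lam * t) * y)) \<partial>gamma_law (q / chi)) \<partial>K s x)"
    by (simp add: ou_op_def nn_op_def dil_def gamma_mix_def s_def)
  also have "\<dots> = (\<integral>\<^sup>+y. ennreal (chi powr (q / chi)) *
      (\<integral>\<^sup>+r. h ((chi * (a * r)) powr (1 / \<alpha>) * y) \<partial>gamma_law (q / chi)) \<partial>K s x)"
    by (intro nn_integral_cong arg_cong2[where f="(*)"] refl)
      (simp only: space_g greaterThan_iff mult.assoc[symmetric, of _ "exp (- lam * t)"] a_scale)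
  also have "\<dots> = ennreal (chi powr (q / chi)) *
      (\<integral>\<^sup>+y. (\<integral>\<^sup>+r. h ((chi * (a * r)) powr (1 / \<alpha>) * y) \<partial>gamma_law (q / chi)) \<partial>K s x)"
    by (rule nn_integral_cmult[OF gm])
  also have "(\<integral>\<^sup>+y. (\<integral>\<^sup>+r. h ((chi * (a * r)) powr (1 / \<alpha>) * y) \<partial>gamma_law (q / chi)) \<partial>K s x) =
      (\<integral>\<^sup>+r. F (a * r) \<partial>gamma_law (q / chi))"
    unfolding F_def by (rule P.Fubini') (use hm_a in simp)
  also have "\<dots> = ennreal (a powr - (q / chi)) *
      (\<integral>\<^sup>+u. ennreal (exp (- u * (1 / a - 1))) * F u \<partial>gamma_law (q / chi))"
    using q chi_pos by (intro nn_integral_gamma_law_scale F) (auto simp: a_def)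
  also have "a powr - (q / chi) = exp (q * t)"
    using chi_pos by (simp add: a_def powr_def)
  also have "1 / a = exp (chi * t)"
    by (simp add: a_def exp_minus inverse_eq_divide)
  finally have eq: "ou_op lam chi (nn_op K) t (gamma_mix \<alpha> chi h q) x =
    ennreal (chi powr (q / chi)) * (ennreal (exp (q * t)) *
      (\<integral>\<^sup>+u. ennreal (exp (- u * (exp (chi * t) - 1))) * F u \<partial>gamma_law (q / chi)))" .
  \<comment> \<open>Here the discount at rate \<open>q\<close> meets the factor
    \<open>a powr - (q / chi)\<close> of the change of variable.\<close>
  have "ennreal (exp (- q * t)) * ennreal (exp (q * t)) = 1"
    by (simp add: ennreal_mult[symmetric] exp_add[symmetric])
  then have "ennreal (exp (- q * t)) * ou_op lam chi (nn_op K) t (gamma_mix \<alpha> chi h q) x =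
    ennreal (chi powr (q / chi)) *
      (\<integral>\<^sup>+u. ennreal (exp (- u * (exp (chi * t) - 1))) * F u \<partial>gamma_law (q / chi))"
    unfolding eq by (subst mult.left_commute, subst mult.assoc[symmetric, of "ennreal (exp (- q * t))"]) simp
  also have "(\<integral>\<^sup>+u. ennreal (exp (- u * (exp (chi * t) - 1))) * F u \<partial>gamma_law (q / chi)) =
    (\<integral>\<^sup>+u. ennreal (exp (- u * (exp (chi * t) - 1))) *
        nn_op K (u * (exp (chi * t) - 1)) h ((chi * u) powr (1 / \<alpha>) * x) \<partial>gamma_law (q / chi))"
    by (intro nn_integral_cong) (simp add: space_g F_eq)
  finally show "ennreal (exp (- q * t)) * ou_op lam chi (nn_op K) t (gamma_mix \<alpha> chi h q) x =
    ennreal (chi powr (q / chi)) *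
      (\<integral>\<^sup>+u. ennreal (exp (- u * (exp (chi * t) - 1))) *
        nn_op K (u * (exp (chi * t) - 1)) h ((chi * u) powr (1 / \<alpha>) * x) \<partial>gamma_law (q / chi))" .
  have "(\<lambda>u. ennreal (exp (- u * (exp (chi * t) - 1))) * F u) \<in> borel_measurable (gamma_law (q / chi))"
    unfolding measurable_cong_sets[OF sets_gamma_law refl]
    by (intro borel_measurable_times_ennreal F measurable_restrict_space1) simp
  then show "(\<lambda>u. ennreal (exp (- u * (exp (chi * t) - 1))) *
        nn_op K (u * (exp (chi * t) - 1)) h ((chi * u) powr (1 / \<alpha>) * x)) \<in> borel_measurable (gamma_law (q / chi))"
    by (rule measurable_cong[THEN iffD1, rotated]) (simp add: space_g F_eq)
qed

text \<open>For \<open>t > 0\<close> and \<open>u > 0\<close> the new time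
  \<open>u * (exp (chi * t) - 1)\<close> is positive, so invariance of \<open>h\<close> applies to
  the integrand pointwise in \<open>u\<close>.\<close>

lemma invariant_gamma_mix_eq:
  assumes inv: "invariant E (nn_op K) 1 h" and lam: "lam > 0" and chi: "chi = \<alpha> * lam"
    and q: "q > 0" and t: "t > 0" and x: "x \<in> E"
  shows "ennreal (exp (- q * t)) * ou_op lam chi (nn_op K) t (gamma_mix \<alpha> chi h q) x =
    gamma_mix \<alpha> chi h q x"
proof -
  have chi_pos: "chi > 0" using alpha_pos lam chi by simp
  have space_g: "space (gamma_law (q / chi)) = {0<..}"
    using sets_eq_imp_space_eq[OF sets_gamma_law] by (simp add: space_restrict_space)
  have h: "h \<in> borel_measurable (borel_on E)" using inv by (simp add: invariant_def)
  have *: "ennreal (exp (- u * (exp (chi * t) - 1))) *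
        nn_op K (u * (exp (chi * t) - 1)) h ((chi * u) powr (1 / \<alpha>) * x) = h ((chi * u) powr (1 / \<alpha>) * x)"
    if "u > 0" for u
  proof -
    have "u * (exp (chi * t) - 1) > 0" "(chi * u) powr (1 / \<alpha>) * x \<in> E"
      using that chi_pos t x E_scale by auto
    then show ?thesis using inv by (simp add: invariant_def)
  qed
  show ?thesis
    unfolding ou_op_gamma_mix(1)[OF h lam chi q less_imp_le[OF t] x] gamma_mix_def
    by (intro arg_cong2[where f="(*)"] refl nn_integral_cong) (simp only: space_g greaterThan_iff *)
qed

lemma invariant_gamma_mix:
  assumes inv: "invariant E (nn_op K) 1 h" and lam: "lam > 0" and chi: "chi = \<alpha> * lam" and q: "q > 0"
  shows "invariant E (ou_op lam chi (nn_op K)) q (gamma_mix \<alpha> chi h q)"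
  unfolding invariant_def
proof (intro conjI ballI allI impI)
  have chi_pos: "chi > 0" using alpha_pos lam chi by simp
  have h: "h \<in> borel_measurable (borel_on E)" using inv by (simp add: invariant_def)
  show "gamma_mix \<alpha> chi h q \<in> borel_measurable (borel_on E)"
    by (rule gamma_mix_measurable[OF h chi_pos])
  fix x assume x: "x \<in> E"
  show *: "ennreal (exp (- q * t)) * ou_op lam chi (nn_op K) t (gamma_mix \<alpha> chi h q) x =
    gamma_mix \<alpha> chi h q x" if "t > 0" for t
    by (rule invariant_gamma_mix_eq[OF inv lam chi q that x])
  show "((\<lambda>t. ennreal (exp (- q * t)) * ou_op lam chi (nn_op K) t (gamma_mix \<alpha> chi h q) x)
      \<longlongrightarrow> gamma_mix \<alpha> chi h q x) (at_right 0)"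
    by (rule tendsto_eventually, rule eventually_mono[OF eventually_at_right_less[of "0::real"]]) (rule *)
qed

text \<open>The inequality is inherited pointwise in \<open>u\<close>. For the limit at 0 the same
  inequality bounds the limsup and Fatou's lemma bounds the liminf, an argument that remains valid
  at points where the mixture is infinite.\<close>

lemma excessive_gamma_mix:
  assumes exc: "excessive E (nn_op K) 1 h" and lam: "lam > 0" and chi: "chi = \<alpha> * lam" and q: "q > 0"
  shows "excessive E (ou_op lam chi (nn_op K)) q (gamma_mix \<alpha> chi h q)"
  unfolding excessive_def
proof (intro conjI ballI allI impI)
  have chi_pos: "chi > 0" using alpha_pos lam chi by simp
  have h: "h \<in> borel_measurable (borel_on E)" using exc by (simp add: excessive_def)
  show "gamma_mix \<alpha> chi h q \<in> borel_measurable (borel_on E)"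
    by (rule gamma_mix_measurable[OF h chi_pos])
  have space_g: "space (gamma_law (q / chi)) = {0<..}"
    using sets_eq_imp_space_eq[OF sets_gamma_law] by (simp add: space_restrict_space)
  fix x assume x: "x \<in> E"
  define H where "H t u = ennreal (exp (- u * (exp (chi * t) - 1))) *
        nn_op K (u * (exp (chi * t) - 1)) h ((chi * u) powr (1 / \<alpha>) * x)" for t u
  have H_le: "H t u \<le> h ((chi * u) powr (1 / \<alpha>) * x)" if "u > 0" "t > 0" for t u
  proof -
    have "u * (exp (chi * t) - 1) > 0" "(chi * u) powr (1 / \<alpha>) * x \<in> E"
      using that chi_pos x E_scale by auto
    then show ?thesis using exc by (simp add: excessive_def H_def)
  qed
  have ou_eq: "ennreal (exp (- q * t)) * ou_op lam chi (nn_op K) t (gamma_mix \<alpha> chi h q) x =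
      ennreal (chi powr (q / chi)) * (\<integral>\<^sup>+u. H t u \<partial>gamma_law (q / chi))" if "t > 0" for t
    unfolding H_def by (rule ou_op_gamma_mix(1)[OF h lam chi q less_imp_le[OF that] x])
  show le: "ennreal (exp (- q * t)) * ou_op lam chi (nn_op K) t (gamma_mix \<alpha> chi h q) x
      \<le> gamma_mix \<alpha> chi h q x" if "t > 0" for t
    unfolding ou_eq[OF that] gamma_mix_def
    by (intro mult_left_mono nn_integral_mono) (auto simp: space_g that intro: H_le)
  have H_lim: "((\<lambda>t. H t u) \<longlongrightarrow> h ((chi * u) powr (1 / \<alpha>) * x)) (at_right 0)" if "u > 0" for u
  proof -
    let ?y = "(chi * u) powr (1 / \<alpha>) * x"
    have y: "?y \<in> E" using that chi_pos x E_scale by auto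
    have lim: "((\<lambda>s. ennreal (exp (- 1 * s)) * nn_op K s h ?y) \<longlongrightarrow> h ?y) (at_right 0)"
      using exc y unfolding excessive_def by blast
    have "filterlim (\<lambda>t. u * (exp (chi * t) - 1)) (at_right 0) (at_right 0)"
      unfolding filterlim_at
    proof (intro conjI)
      show "\<forall>\<^sub>F t in at_right 0. u * (exp (chi * t) - 1) \<in> {0<..} \<and> u * (exp (chi * t) - 1) \<noteq> 0"
        using eventually_at_right_less[of "0::real"] by eventually_elim (use that chi_pos in auto)
      show "((\<lambda>t. u * (exp (chi * t) - 1)) \<longlongrightarrow> 0) (at_right 0)"
        by (rule tendsto_eq_intros refl | simp)+
    qed
    from filterlim_compose[OF lim this] show ?thesis by (simp add: H_def)
  qed
  show "((\<lambda>t. ennreal (exp (- q * t)) * ou_op lam chi (nn_op K) t (gamma_mix \<alpha> chi h q) x)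
      \<longlongrightarrow> gamma_mix \<alpha> chi h q x) (at_right 0)"
    \<comment> \<open>Fatou's lemma concerns sequences, so the limit along \<open>at_right 0\<close>
      is tested on sequences of positive times.\<close>
    unfolding tendsto_at_iff_sequentially
  proof (intro allI impI)
    fix T :: "nat \<Rightarrow> real" assume T: "\<forall>i. T i \<in> {0<..} - {0}" "T \<longlonglongrightarrow> 0"
    then have Tpos: "T i > 0" for i by auto
    have Tlim: "filterlim T (at_right 0) sequentially"
      unfolding filterlim_at using T(2) Tpos by (auto intro!: always_eventually simp: less_le)
    have Hm: "H (T i) \<in> borel_measurable (gamma_law (q / chi))" for i
      unfolding H_def by (rule ou_op_gamma_mix(2)[OF h lam chi q less_imp_le[OF Tpos] x])
    let ?C = "ennreal (chi powr (q / chi))"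
    let ?A = "\<lambda>i. ?C * (\<integral>\<^sup>+u. H (T i) u \<partial>gamma_law (q / chi))"
    have "(\<integral>\<^sup>+u. h ((chi * u) powr (1 / \<alpha>) * x) \<partial>gamma_law (q / chi)) =
        (\<integral>\<^sup>+u. liminf (\<lambda>i. H (T i) u) \<partial>gamma_law (q / chi))"
      by (intro nn_integral_cong lim_imp_Liminf[symmetric])
        (auto simp: space_g intro: filterlim_compose[OF H_lim Tlim])
    also have "\<dots> \<le> liminf (\<lambda>i. \<integral>\<^sup>+u. H (T i) u \<partial>gamma_law (q / chi))"
      by (rule nn_integral_liminf[OF Hm])
    finally have "gamma_mix \<alpha> chi h q x \<le> ?C * liminf (\<lambda>i. \<integral>\<^sup>+u. H (T i) u \<partial>gamma_law (q / chi))"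
      unfolding gamma_mix_def by (intro mult_left_mono) auto
    also have "\<dots> = liminf ?A"
      \<comment> \<open>Multiplication by the finite constant \<open>?C\<close> is continuous and
        monotone on \<open>ennreal\<close>, hence commutes with the liminf.\<close>
      by (rule Liminf_compose_continuous_mono[symmetric])
        (auto intro!: ennreal_continuous_on_cmult continuous_on_id monoI mult_left_mono)
    finally have 1: "gamma_mix \<alpha> chi h q x \<le> liminf ?A" .
    have "?A i \<le> gamma_mix \<alpha> chi h q x" for i
      using le[OF Tpos[of i]] by (simp only: ou_eq[OF Tpos])
    then have 2: "limsup ?A \<le> gamma_mix \<alpha> chi h q x"
      by (intro Limsup_bounded) auto
    have "?A \<longlonglongrightarrow> gamma_mix \<alpha> chi h q x"
      using 1 2 Liminf_le_Limsup[of sequentially ?A] by (intro Liminf_eq_Limsup) auto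
    then show "((\<lambda>t. ennreal (exp (- q * t)) * ou_op lam chi (nn_op K) t (gamma_mix \<alpha> chi h q) x) \<circ> T)
        \<longlonglongrightarrow> gamma_mix \<alpha> chi h q x"
      by (simp only: comp_def ou_eq[OF Tpos])
  qed
qed

text \<open>This is the invariance under \<open>Q\<^sub>s\<close> read in the clock of
  \<open>X\<close>, with \<open>s\<close> chosen so that \<open>e_chi chi s = t\<close>. Time 0 is
  separate, since the invariance identity is stated for positive times.\<close>

lemma self_similar_gamma_mix:
  assumes inv: "invariant E (nn_op K) 1 h" and lam: "lam > 0" and chi: "chi = \<alpha> * lam" and q: "q > 0"
    and x: "x \<in> E" and t: "t \<ge> 0"
  shows "ennreal ((1 + chi * t) powr (- q / chi)) *
            nn_op K t (dil ((1 + chi * t) powr (- 1 / \<alpha>)) (gamma_mix \<alpha> chi h q)) x =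
          gamma_mix \<alpha> chi h q x"
proof (cases "t = 0")
  case True
  have chi_pos: "chi > 0" using alpha_pos lam chi by simp
  have h: "h \<in> borel_measurable (borel_on E)" using inv by (simp add: invariant_def)
  show ?thesis
    using True x gamma_mix_measurable[OF h chi_pos]
    by (simp add: nn_op_def dil_def kernel_zero nn_integral_return space_borel_on)
next
  case False
  have chi_pos: "chi > 0" using alpha_pos lam chi by simp
  have pos: "1 + chi * t > 1" using t False chi_pos by simp
  \<comment> \<open>The inverse of \<open>e_chi chi\<close> at \<open>t\<close>.\<close>
  define s where "s = ln (1 + chi * t) / chi"
  have s: "s > 0" using pos chi_pos by (simp add: s_def)
  have "e_chi chi s = t" "exp (- lam * s) = (1 + chi * t) powr (- 1 / \<alpha>)"
    "exp (- q * s) = (1 + chi * t) powr (- q / chi)"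
    using pos chi_pos lam alpha_pos by (auto simp: s_def e_chi_def powr_def chi)
  then show ?thesis
    using invariant_gamma_mix_eq[OF inv lam chi q s x] by (simp add: ou_op_def)
qed

end

section \<open>Functions vanishing at infinity and the Feller property\<close>

text \<open>A continuous approximation from below to the indicator of an open \<open>W\<close>. The
  first factor cuts off near the complement; \<open>W = UNIV\<close> is separate because
  \<open>infdist\<close> to the empty set is 0 by convention. The second factor decays at infinity
  for fixed \<open>n\<close> and tends to 1 as \<open>n\<close> grows.\<close>

definition bump :: "nat \<Rightarrow> real set \<Rightarrow> real \<Rightarrow> real" where
  "bump n W x = (if W = UNIV then 1 else min 1 (real (Suc n) * infdist x (- W))) *
     (real (Suc n) / (real (Suc n) + x\<^sup>2))"

lemma bump_continuous: "continuous_on UNIV (bump n W)"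
proof -
  have "real (Suc n) + x\<^sup>2 \<noteq> 0" for x :: real
    using zero_le_power2[of x] by (auto simp: add_nonneg_eq_0_iff)
  then show ?thesis
    unfolding bump_def by (cases "W = UNIV") (auto intro!: continuous_intros)
qed

lemma bump_nonneg: "0 \<le> bump n W x"
  by (simp add: bump_def infdist_nonneg)

lemma bump_weight_le: "real (Suc n) / (real (Suc n) + x\<^sup>2) \<le> real (Suc n) / (1 + x\<^sup>2)"
  by (rule divide_left_mono) (auto intro!: mult_pos_pos add_pos_nonneg)

lemma bump_le_weight: "bump n W x \<le> real (Suc n) / (real (Suc n) + x\<^sup>2)"
proof -
  have "(if W = UNIV then 1 else min 1 (real (Suc n) * infdist x (- W))) *
     (real (Suc n) / (real (Suc n) + x\<^sup>2)) \<le> 1 * (real (Suc n) / (real (Suc n) + x\<^sup>2))"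
    by (rule mult_right_mono) auto
  then show ?thesis by (simp add: bump_def)
qed

lemma bump_le: "\<bar>bump n W x\<bar> \<le> real (Suc n) / (1 + x\<^sup>2)"
  using bump_le_weight[of n W x] bump_weight_le[of n x] bump_nonneg[of n W x] by linarith

lemma bump_le_1: "bump n W x \<le> 1"
proof -
  have "real (Suc n) / (real (Suc n) + x\<^sup>2) \<le> 1"
    by (subst divide_le_eq_1_pos) (auto intro: add_pos_nonneg)
  then show ?thesis using bump_le_weight[of n W x] by linarith
qed

text \<open>Valid for every \<open>n\<close>, so a single bump already detects whether a measure
  charges \<open>W\<close>.\<close>

lemma bump_pos_iff:
  assumes "open W"
  shows "0 < bump n W x \<longleftrightarrow> x \<in> W"
proof (cases "W = UNIV")
  case True
  have "real (Suc n) + x\<^sup>2 > 0" by (intro add_pos_nonneg) auto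
  then show ?thesis using True by (simp add: bump_def)
next
  case False
  have "real (Suc n) + x\<^sup>2 > 0" by (intro add_pos_nonneg) auto
  then have w: "real (Suc n) / (real (Suc n) + x\<^sup>2) > 0" by simp
  have i: "0 < infdist x (- W) \<longleftrightarrow> x \<in> W"
    using in_closed_iff_infdist_zero[of "- W" x] False assms infdist_nonneg[of x "- W"]
    by (auto simp: less_le closed_def)
  have "0 < bump n W x \<longleftrightarrow> 0 < min 1 (real (Suc n) * infdist x (- W))"
    unfolding bump_def using w False by (simp only: if_False zero_less_mult_iff) auto
  also have "\<dots> \<longleftrightarrow> 0 < infdist x (- W)"
    by (simp add: zero_less_mult_iff)
  finally show ?thesis using i by simp
qed

lemma bump_tendsto:
  assumes "open W"
  shows "(\<lambda>n. bump n W x) \<longlonglongrightarrow> indicator W x"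
proof -
  have w: "(\<lambda>n. real (Suc n) / (real (Suc n) + x\<^sup>2)) \<longlonglongrightarrow> 1"
  proof -
    have "(\<lambda>n. real n / (real n + x\<^sup>2)) \<longlonglongrightarrow> 1" by real_asymp
    then show ?thesis by (rule LIMSEQ_Suc)
  qed
  have b: "(\<lambda>n. if W = UNIV then 1 else min 1 (real (Suc n) * infdist x (- W))) \<longlonglongrightarrow> indicator W x"
  proof (cases "W = UNIV \<or> x \<notin> W")
    case True
    then show ?thesis by (cases "W = UNIV") (simp_all add: infdist_zero)
  next
    case False
    then have i: "0 < infdist x (- W)"
      using in_closed_iff_infdist_zero[of "- W" x] assms infdist_nonneg[of x "- W"]
      by (auto simp: less_le closed_def)
    have "\<forall>\<^sub>F n in sequentially. (1::real) = min 1 (real (Suc n) * infdist x (- W))"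
    proof -
      obtain N where N: "1 / infdist x (- W) \<le> real N" using real_arch_simple by blast
      show ?thesis
        using eventually_ge_at_top[of N]
      proof eventually_elim
        case (elim n)
        then have "1 / infdist x (- W) \<le> real (Suc n)" using N by linarith
        then show ?case using i by (simp add: divide_le_eq)
      qed
    qed
    then have "(\<lambda>n. min 1 (real (Suc n) * infdist x (- W))) \<longlonglongrightarrow> 1"
      by (rule Lim_transform_eventually[OF tendsto_const])
    then show ?thesis using False by simp
  qed
  show ?thesis unfolding bump_def using tendsto_mult[OF b w] by simp
qed

text \<open>As \<open>E\<close> is closed, its intersections with closed balls are compact, so decay
  at infinity is enough.\<close>

lemma C0I:
  assumes E: "closed E" and f: "continuous_on UNIV f" and B: "\<And>x. \<bar>f x\<bar> \<le> B / (1 + x\<^sup>2)"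
  shows "f \<in> C0 E"
  unfolding C0_def
proof (intro CollectI conjI allI impI)
  show "continuous_on E f" using f continuous_on_subset by blast
  fix e :: real assume e: "e > 0"
  \<comment> \<open>Chosen so that \<open>x\<^sup>2 > \<bar>B\<bar> / e\<close> outside the ball of
    radius \<open>R\<close>, which pushes \<open>B / (1 + x\<^sup>2)\<close> below
    \<open>e\<close>.\<close>
  define R where "R = sqrt (\<bar>B\<bar> / e)"
  have "\<bar>f x\<bar> < e" if "x \<notin> cball 0 R" for x
  proof -
    have "sqrt (\<bar>B\<bar> / e) < sqrt (x\<^sup>2)" using that by (simp add: R_def)
    then have "\<bar>B\<bar> / e < x\<^sup>2" by (simp only: real_sqrt_less_iff)
    then have "\<bar>B\<bar> < e * (1 + x\<^sup>2)" using e by (simp add: divide_less_eq algebra_simps)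
    moreover have "1 + x\<^sup>2 > 0" by (simp add: add_pos_nonneg)
    ultimately have "B / (1 + x\<^sup>2) < e" by (simp add: divide_less_eq)
    then show ?thesis using B[of x] by linarith
  qed
  then show "\<exists>C\<subseteq>E. compact C \<and> (\<forall>x\<in>E - C. \<bar>f x\<bar> < e)"
    by (intro exI[of _ "E \<inter> cball 0 R"]) (auto intro: closed_Int_compact E)
qed

lemma bump_in_C0: "closed E \<Longrightarrow> bump n W \<in> C0 E"
  by (rule C0I[OF _ bump_continuous bump_le])

lemma C0_measurable: "f \<in> C0 E \<Longrightarrow> f \<in> borel_measurable (borel_on E)"
  by (auto simp: C0_def intro: borel_measurable_continuous_on_restrict)

lemma C0_bounded:
  assumes "f \<in> C0 E"
  obtains B where "B \<ge> 0" "\<And>x. x \<in> E \<Longrightarrow> \<bar>f x\<bar> \<le> B"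
proof -
  obtain C where C: "C \<subseteq> E" "compact C" "\<forall>x\<in>E - C. \<bar>f x\<bar> < 1"
    using assms by (auto simp: C0_def dest: spec[of _ 1])
  have "continuous_on C f" using assms C(1) by (auto simp: C0_def intro: continuous_on_subset)
  then have "bounded (f ` C)" using C(2) compact_continuous_image compact_imp_bounded by blast
  then obtain A where A: "\<And>x. x \<in> C \<Longrightarrow> \<bar>f x\<bar> \<le> A" by (auto simp: bounded_iff)
  show ?thesis
  proof (rule that[of "max 1 A"])
    fix x assume "x \<in> E"
    then show "\<bar>f x\<bar> \<le> max 1 A" using A[of x] C(3) by (cases "x \<in> C") (auto simp: less_imp_le le_max_iff_disj)
  qed simp
qed

lemma C0_bounded_borel: "f \<in> C0 E \<Longrightarrow> bounded_borel E f"
proof -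
  assume f: "f \<in> C0 E"
  obtain B where "\<And>x. x \<in> E \<Longrightarrow> \<bar>f x\<bar> \<le> B" using C0_bounded[OF f] by blast
  then have "bounded (f ` E)" by (intro boundedI[where B=B]) auto
  then show ?thesis using C0_measurable[OF f] by (simp add: bounded_borel_def)
qed

text \<open>Bumps recover the measure of every relatively open set by dominated convergence, and
  open sets form an intersection-stable generator of the Borel sets.\<close>

lemma finite_measure_eqI_C0:
  assumes "closed E" "finite_measure \<mu>" "finite_measure \<nu>"
    and \<mu>: "sets \<mu> = sets (borel_on E)" and \<nu>: "sets \<nu> = sets (borel_on E)"
    and eq: "\<And>f. f \<in> C0 E \<Longrightarrow> (\<integral>x. f x \<partial>\<mu>) = (\<integral>x. f x \<partial>\<nu>)"
  shows "\<mu> = \<nu>"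
proof -
  interpret \<mu>: finite_measure \<mu> by fact
  interpret \<nu>: finite_measure \<nu> by fact
  have E: "E \<in> sets borel" using assms(1) by simp
  have sp: "space \<mu> = E" "space \<nu> = E"
    using \<mu>[THEN sets_eq_imp_space_eq] \<nu>[THEN sets_eq_imp_space_eq] by (auto simp: space_restrict_space)
  have lim: "(\<lambda>n. \<integral>x. bump n W x \<partial>M) \<longlonglongrightarrow> measure M (E \<inter> W)"
    if "open W" "finite_measure M" and M: "sets M = sets (borel_on E)" and sp: "space M = E" for W M
  proof -
    interpret M: finite_measure M by fact
    have EW: "E \<inter> W \<in> sets M" using that E by (simp add: M sets_restrict_space)
    have "(\<lambda>n. \<integral>x. bump n W x \<partial>M) \<longlonglongrightarrow> (\<integral>x. indicator W x \<partial>M)"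
    proof (rule integral_dominated_convergence[where w="\<lambda>_. 1"])
      show "indicator W \<in> borel_measurable M" "bump n W \<in> borel_measurable M" for n
        using that(1) borel_measurable_continuous_onI[OF bump_continuous]
        by (auto simp: measurable_cong_sets[OF M refl] intro!: measurable_restrict_space1)
    qed (auto intro!: bump_tendsto that bump_le_1 simp: bump_nonneg)
    also have "(\<integral>x. indicator W x \<partial>M) = (\<integral>x. indicator (E \<inter> W) x \<partial>M)"
      by (rule Bochner_Integration.integral_cong) (auto simp: sp indicator_def)
    also have "\<dots> = measure M (E \<inter> W)" using EW by simp
    finally show ?thesis .
  qed
  have open_eq: "emeasure \<mu> (E \<inter> W) = emeasure \<nu> (E \<inter> W)" if "open W" for W
  proof -
    have "(\<lambda>n. \<integral>x. bump n W x \<partial>\<mu>) \<longlonglongrightarrow> measure \<nu> (E \<inter> W)"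
      unfolding eq[OF bump_in_C0[OF assms(1)]] by (rule lim[OF that assms(3) \<nu> sp(2)])
    with lim[OF that assms(2) \<mu> sp(1)] have "measure \<mu> (E \<inter> W) = measure \<nu> (E \<inter> W)"
      by (rule LIMSEQ_unique)
    then show ?thesis by (simp add: \<mu>.emeasure_eq_measure \<nu>.emeasure_eq_measure)
  qed
  \<comment> \<open>Both measures are pushed forward to the line, where \<open>borel\<close> is
    generated by the open sets.\<close>
  have id: "(\<lambda>x. x) \<in> \<mu> \<rightarrow>\<^sub>M borel" "(\<lambda>x. x) \<in> \<nu> \<rightarrow>\<^sub>M borel"
    by (auto simp: measurable_cong_sets[OF \<mu> refl] measurable_cong_sets[OF \<nu> refl]
        intro!: measurable_restrict_space1)
  have d: "emeasure (distr \<mu> borel (\<lambda>x. x)) A = emeasure \<mu> (E \<inter> A)"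
    "emeasure (distr \<nu> borel (\<lambda>x. x)) A = emeasure \<nu> (E \<inter> A)" if "A \<in> sets borel" for A
    using that by (simp_all add: emeasure_distr[OF id(1)] emeasure_distr[OF id(2)] sp Int_commute)
  have "distr \<mu> borel (\<lambda>x. x) = distr \<nu> borel (\<lambda>x. x)"
  proof (rule measure_eqI_generator_eq[where \<Omega>=UNIV and E="{S. open S}" and A="\<lambda>_. UNIV"])
    show "Int_stable {S :: real set. open S}" by (auto simp: Int_stable_def)
    show "emeasure (distr \<mu> borel (\<lambda>x. x)) W = emeasure (distr \<nu> borel (\<lambda>x. x)) W"
      if "W \<in> {S. open S}" for W
      using that by (simp add: d open_eq)
    show "emeasure (distr \<mu> borel (\<lambda>x. x)) UNIV \<noteq> \<infinity>" by (simp add: d)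
  qed (auto simp: borel_def)
  then have "emeasure \<mu> (E \<inter> A) = emeasure \<nu> (E \<inter> A)" if "A \<in> sets borel" for A
    using d[OF that] by simp
  then show ?thesis
    by (intro measure_eqI) (auto simp: \<mu> \<nu> sets_restrict_space)
qed

section \<open>The semigroup on bounded functions and its continuity in time and space at the
  origin\<close>

context self_similar_feller
begin

lemma integrable_K:
  assumes "t \<ge> 0" "x \<in> E" "f \<in> borel_measurable (borel_on E)" "\<And>y. y \<in> E \<Longrightarrow> \<bar>f y\<bar> \<le> (B::real)"
  shows "integrable (K t x) f"
proof -
  interpret subprob_space "K t x" by (rule subprob_K[OF assms(1,2)])
  show ?thesis
    by (rule integrable_const_bound[where B=B])
      (use assms(3,4) in \<open>auto simp: space_K[OF assms(1,2)] measurable_cong_sets[OF sets_K[OF assms(1,2)] refl]\<close>)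
qed

text \<open>The sign of \<open>B\<close> matters twice: the kernels are only sub-Markovian, and a
  non-integrable \<open>f\<close> has Bochner integral 0 by convention.\<close>

lemma real_op_abs_le:
  assumes "t \<ge> 0" "x \<in> E" "\<And>y. y \<in> E \<Longrightarrow> \<bar>f y\<bar> \<le> B" "B \<ge> 0"
  shows "\<bar>real_op K t f x\<bar> \<le> B"
proof (cases "integrable (K t x) f")
  case True
  interpret subprob_space "K t x" by (rule subprob_K[OF assms(1,2)])
  have "\<bar>real_op K t f x\<bar> \<le> (\<integral>y. \<bar>f y\<bar> \<partial>K t x)"
    unfolding real_op_def by (rule integral_abs_bound)
  also have "\<dots> \<le> (\<integral>y. B \<partial>K t x)"
    using True assms(3) by (intro integral_mono) (auto simp: space_K[OF assms(1,2)])
  also have "\<dots> \<le> B * 1"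
    using assms(4) subprob_measure_le_1[of "space (K t x)"] by (simp add: mult_left_le_one_le)
  finally show ?thesis by simp
qed (use assms(4) in \<open>simp add: real_op_def not_integrable_integral_eq\<close>)

lemma real_op_measurable:
  assumes "t \<ge> 0" "f \<in> borel_measurable (borel_on E)"
  shows "real_op K t f \<in> borel_measurable (borel_on E)"
  unfolding real_op_def[abs_def]
  by (rule measurable_compose[OF kernel_measurable[OF assms(1)]
        integral_measurable_subprob_algebra[OF assms(2)]])

lemma real_op_add:
  assumes s: "s \<ge> 0" and t: "t \<ge> 0" and x: "x \<in> E" and f: "f \<in> borel_measurable (borel_on E)"
    and B: "\<And>y. y \<in> E \<Longrightarrow> \<bar>f y\<bar> \<le> B"
  shows "real_op K (s + t) f x = real_op K s (real_op K t f) x"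
proof -
  interpret subprob_space "K s x" by (rule subprob_K[OF s x])
  have "K t \<in> K s x \<rightarrow>\<^sub>M subprob_algebra (borel_on E)"
    using kernel_measurable[OF t] by (simp add: measurable_cong_sets[OF sets_K[OF s x] refl])
  moreover have "AE y in K s x. emeasure (K t y) (space (K t y)) \<le> ennreal 1"
    using subprob_space.subprob_emeasure_le_1[OF subprob_K[OF t]] by (intro AE_I2) (simp add: space_K[OF s x])
  moreover have "\<bar>f y\<bar> \<le> B" if "y \<in> space (borel_on E)" for y
    using B that by (simp add: space_borel_on)
  ultimately show ?thesis
    unfolding real_op_def kernel_add[OF s t x]
    using integral_bind[OF f _ _ finite_measure_axioms] by blast
qed

text \<open>Time and starting point move together. Splitting \<open>t\<^sub>0\<close> at
  \<open>\<tau> i\<close> writes the time error as the sub-Markovian operator at time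
  \<open>\<tau> i\<close> applied to the difference of
  \<open>real_op K (t\<^sub>0 - \<tau> i) f\<close> and \<open>f\<close>, which is uniformly small
  by strong continuity at 0. Approach strictly from below makes this splitting possible; the moving
  point is handled by continuity at time \<open>t\<^sub>0\<close>.\<close>

lemma real_op_tendsto:
  assumes f: "f \<in> C0 E" and E0: "0 \<in> E"
    and \<tau>: "(\<tau> \<longlongrightarrow> t\<^sub>0) F" "\<forall>\<^sub>F i in F. 0 \<le> \<tau> i \<and> \<tau> i < t\<^sub>0"
    and y: "(y \<longlongrightarrow> 0) F" "\<forall>\<^sub>F i in F. y i \<in> E" and t\<^sub>0: "t\<^sub>0 \<ge> 0"
  shows "((\<lambda>i. real_op K (\<tau> i) f (y i)) \<longlongrightarrow> real_op K t\<^sub>0 f 0) F"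
proof -
  obtain B where B: "B \<ge> 0" "\<And>x. x \<in> E \<Longrightarrow> \<bar>f x\<bar> \<le> B" using C0_bounded[OF f] by blast
  have fm: "f \<in> borel_measurable (borel_on E)" by (rule C0_measurable[OF f])
  have "continuous_on E (real_op K t\<^sub>0 f)"
    using feller f t\<^sub>0 by (auto simp: feller_semigroup_def C0_def)
  from continuous_on_tendsto_compose[OF this y(1) E0 y(2)]
  have 1: "((\<lambda>i. real_op K t\<^sub>0 f (y i)) \<longlongrightarrow> real_op K t\<^sub>0 f 0) F" .
  have diff: "filterlim (\<lambda>i. t\<^sub>0 - \<tau> i) (at_right 0) F"
    unfolding filterlim_at
  proof (intro conjI)
    show "\<forall>\<^sub>F i in F. t\<^sub>0 - \<tau> i \<in> {0<..} \<and> t\<^sub>0 - \<tau> i \<noteq> 0"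
      using \<tau>(2) by eventually_elim auto
    show "((\<lambda>i. t\<^sub>0 - \<tau> i) \<longlongrightarrow> 0) F"
      using tendsto_diff[OF tendsto_const \<tau>(1), of t\<^sub>0] by simp
  qed
  have ul: "uniform_limit E (\<lambda>t. real_op K t f) f (at_right 0)"
    using feller f by (auto simp: feller_semigroup_def)
  have 2: "((\<lambda>i. real_op K t\<^sub>0 f (y i) - real_op K (\<tau> i) f (y i)) \<longlongrightarrow> 0) F"
  proof (rule tendstoI)
    fix e :: real assume e: "e > 0"
    have "\<forall>\<^sub>F i in F. \<forall>x\<in>E. dist (real_op K (t\<^sub>0 - \<tau> i) f x) (f x) < e / 2"
      by (rule eventually_compose_filterlim[OF uniform_limitD[OF ul] diff]) (use e in simp)
    with \<tau>(2) y(2) show "\<forall>\<^sub>F i in F. dist (real_op K t\<^sub>0 f (y i) - real_op K (\<tau> i) f (y i)) 0 < e"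
    proof eventually_elim
      case (elim i)
      define g where "g = real_op K (t\<^sub>0 - \<tau> i) f"
      have \<tau>i: "0 \<le> \<tau> i" "0 \<le> t\<^sub>0 - \<tau> i" and yi: "y i \<in> E" using elim(1,2) by auto
      have gm: "g \<in> borel_measurable (borel_on E)"
        unfolding g_def by (rule real_op_measurable[OF \<tau>i(2) fm])
      have gB: "\<bar>g x\<bar> \<le> B" if "x \<in> E" for x
        unfolding g_def by (rule real_op_abs_le[OF \<tau>i(2) that B(2,1)])
      have "real_op K t\<^sub>0 f (y i) = real_op K (\<tau> i) g (y i)"
        using real_op_add[OF \<tau>i yi fm B(2)] by (simp add: g_def)
      also have "real_op K (\<tau> i) g (y i) - real_op K (\<tau> i) f (y i) = real_op K (\<tau> i) (\<lambda>x. g x - f x) (y i)"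
        unfolding real_op_def
        by (rule Bochner_Integration.integral_diff[symmetric])
          (rule integrable_K[OF \<tau>i(1) yi gm gB] integrable_K[OF \<tau>i(1) yi fm B(2)], assumption)+
      finally have eq: "real_op K t\<^sub>0 f (y i) - real_op K (\<tau> i) f (y i) = real_op K (\<tau> i) (\<lambda>x. g x - f x) (y i)" .
      have "\<bar>g x - f x\<bar> \<le> e / 2" if "x \<in> E" for x
        using elim(3) that by (auto simp: dist_real_def g_def less_imp_le)
      then have "\<bar>real_op K (\<tau> i) (\<lambda>x. g x - f x) (y i)\<bar> \<le> e / 2"
        using e by (intro real_op_abs_le[OF \<tau>i(1) yi]) auto
      then show ?case using e by (simp add: eq dist_real_def)
    qed
  qed
  from tendsto_diff[OF 1 2] show ?thesis by simp
qed

end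

section \<open>The limit law of the Ornstein-Uhlenbeck process\<close>

locale ou_realization = self_similar_feller +
  fixes lam chi :: real and Pr :: "real \<Rightarrow> 'w measure" and X :: "real \<Rightarrow> 'w \<Rightarrow> real"
  assumes lam_pos: "lam > 0" and chi_eq: "chi = \<alpha> * lam"
    and E_closed: "closed E" and zero_E: "0 \<in> E"
    and realization: "realization E K Pr X"
begin

lemma chi_pos: "chi > 0"
  using alpha_pos lam_pos by (simp add: chi_eq)

lemma e_chi_nonneg: "t \<ge> 0 \<Longrightarrow> e_chi chi t \<ge> 0"
  using chi_pos by (simp add: e_chi_def)

lemma e_chi_mono: "s \<le> t \<Longrightarrow> e_chi chi s \<le> e_chi chi t"
  using chi_pos by (simp add: e_chi_def divide_right_mono)

text \<open>After time \<open>s\<close> the clock of \<open>X\<close> runs faster by the factor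
  \<open>exp (chi * s)\<close>.\<close>

lemma e_chi_add: "e_chi chi (s + t) = e_chi chi s + exp (chi * s) * e_chi chi t"
  using chi_pos by (simp add: e_chi_def exp_add field_simps)

lemma prob_Pr: "x \<in> E \<Longrightarrow> prob_space (Pr x)"
  using realization by (simp add: realization_def)

lemma X_measurable: "x \<in> E \<Longrightarrow> t \<ge> 0 \<Longrightarrow> X t \<in> Pr x \<rightarrow>\<^sub>M borel_on E"
  using realization by (simp add: realization_def)

lemma X_in_E: "x \<in> E \<Longrightarrow> t \<ge> 0 \<Longrightarrow> w \<in> space (Pr x) \<Longrightarrow> X t w \<in> E"
  using measurable_space[OF X_measurable] by (simp add: space_borel_on)

lemma X_borel_measurable: "x \<in> E \<Longrightarrow> t \<ge> 0 \<Longrightarrow> X t \<in> borel_measurable (Pr x)"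
  using X_measurable measurable_restrict_space2_iff by blast

lemma natural_filtration_subalgebra:
  assumes "x \<in> E"
  shows "subalgebra (Pr x) (natural_filtration (Pr x) X s)"
proof -
  have "X u -` B \<inter> space (Pr x) \<in> sets (Pr x)" if "u \<in> {0..s}" "B \<in> sets borel" for u B
    using X_borel_measurable[OF assms] that by (auto intro: measurable_sets)
  then show ?thesis
    unfolding subalgebra_def natural_filtration_def
    by (auto intro!: sets.sigma_sets_subset simp: sets_measure_of_conv)
qed

lemma space_natural_filtration: "space (natural_filtration (Pr x) X s) = space (Pr x)"
  by (simp add: natural_filtration_def space_measure_of_conv)

lemma natural_filtration_measurable:
  assumes "0 \<le> u" "u \<le> s"
  shows "X u \<in> borel_measurable (natural_filtration (Pr x) X s)"
proof (rule measurableI)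
  fix B :: "real set" assume "B \<in> sets borel"
  then show "X u -` B \<inter> space (natural_filtration (Pr x) X s) \<in> sets (natural_filtration (Pr x) X s)"
    unfolding space_natural_filtration unfolding natural_filtration_def
    using assms by (subst sets_measure_of) (force intro!: sigma_sets.Basic)+
qed simp

text \<open>The Markov property integrated over an event of the past; later arguments use it only in
  this form, free of conditional expectations.\<close>

lemma markov:
  assumes x: "x \<in> E" and s: "s \<ge> 0" and t: "t \<ge> 0" and f: "bounded_borel E f"
    and A: "A \<in> sets (natural_filtration (Pr x) X s)"
  shows "(\<integral>w. indicator A w * f (X (s + t) w) \<partial>Pr x) =
    (\<integral>w. indicator A w * real_op K t f (X s w) \<partial>Pr x)"
proof -
  let ?F = "natural_filtration (Pr x) X s"
  interpret prob_space "Pr x" by (rule prob_Pr[OF x])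
  interpret finite_measure_subalgebra "Pr x" ?F
    by unfold_locales (rule natural_filtration_subalgebra[OF x])
  have st: "s + t \<ge> 0" using s t by simp
  obtain B where B: "\<And>y. y \<in> E \<Longrightarrow> \<bar>f y\<bar> \<le> B"
    using f by (auto simp: bounded_borel_def bounded_iff)
  have fm: "f \<in> borel_measurable (borel_on E)" using f by (simp add: bounded_borel_def)
  have "(\<lambda>w. f (X (s + t) w)) \<in> borel_measurable (Pr x)"
    by (rule measurable_compose[OF X_measurable[OF x st] fm])
  then have int: "integrable (Pr x) (\<lambda>w. f (X (s + t) w))"
    by (rule integrable_const_bound[where B=B, rotated]) (auto intro!: AE_I2 B X_in_E x st)
  have AM: "A \<in> sets (Pr x)" using A natural_filtration_subalgebra[OF x, of s] by (auto simp: subalgebra_def)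
  have am: "(\<lambda>w. indicator A w * real_op K t f (X s w)) \<in> borel_measurable (Pr x)"
    using AM by (intro borel_measurable_times measurable_compose[OF X_measurable[OF x s] real_op_measurable[OF t fm]]) auto
  have "AE w in Pr x. real_cond_exp (Pr x) ?F (\<lambda>w. f (X (s + t) w)) w = real_op K t f (X s w)"
    using realization x s t f by (simp add: realization_def)
  then have "(\<integral>w. indicator A w * real_cond_exp (Pr x) ?F (\<lambda>w. f (X (s + t) w)) w \<partial>Pr x) =
      (\<integral>w. indicator A w * real_op K t f (X s w) \<partial>Pr x)"
    using AM am by (intro integral_cong_AE) (auto intro!: borel_measurable_times)
  then show ?thesis
    using real_cond_exp_intA[OF int A] by (simp add: set_lebesgue_integral_def)
qed

text \<open>The Markov property at time 0 with the whole space as past event, combined with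
  \<open>X 0 w = x\<close> almost surely.\<close>

lemma law_X:
  assumes x: "x \<in> E" and t: "t \<ge> 0"
  shows "K t x = distr (Pr x) (borel_on E) (X t)"
proof (rule measure_eqI)
  show "sets (K t x) = sets (distr (Pr x) (borel_on E) (X t))" by (simp add: sets_K x t)
  fix A assume "A \<in> sets (K t x)"
  then have A: "A \<in> sets (borel_on E)" by (simp add: sets_K x t)
  interpret prob_space "Pr x" by (rule prob_Pr[OF x])
  interpret K: subprob_space "K t x" by (rule subprob_K[OF t x])
  have bb: "bounded_borel E (indicator A)"
    unfolding bounded_borel_def using A by (auto intro!: boundedI[where B=1] simp: indicator_def)
  have top: "space (Pr x) \<in> sets (natural_filtration (Pr x) X 0)"
    using sets.top[of "natural_filtration (Pr x) X 0"] by (simp add: space_natural_filtration)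
  have pre: "X t -` A \<inter> space (Pr x) \<in> sets (Pr x)" by (rule measurable_sets[OF X_measurable[OF x t] A])
  have "measure (Pr x) (X t -` A \<inter> space (Pr x)) =
      (\<integral>w. indicator (space (Pr x)) w * indicat_real A (X (0 + t) w) \<partial>Pr x)"
  proof -
    have "(\<integral>w. indicator (space (Pr x)) w * indicat_real A (X (0 + t) w) \<partial>Pr x) =
        (\<integral>w. indicat_real (X t -` A \<inter> space (Pr x)) w \<partial>Pr x)"
      by (rule Bochner_Integration.integral_cong) (auto simp: indicator_def)
    then show ?thesis using pre by simp
  qed
  also have "\<dots> = (\<integral>w. indicator (space (Pr x)) w * real_op K t (indicator A) (X 0 w) \<partial>Pr x)"
    by (rule markov[OF x order_refl t bb top])
  also have "\<dots> = (\<integral>w. real_op K t (indicator A) x \<partial>Pr x)"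
  proof (rule integral_cong_AE)
    have am: "(\<lambda>w. real_op K t (indicator A) (X 0 w)) \<in> borel_measurable (Pr x)"
      using A by (intro measurable_compose[OF X_measurable[OF x order_refl]] real_op_measurable t) auto
    then show "(\<lambda>w. indicator (space (Pr x)) w * real_op K t (indicator A) (X 0 w)) \<in> borel_measurable (Pr x)"
      by (intro borel_measurable_times) auto
    have "AE w in Pr x. X 0 w = x" using realization x by (simp add: realization_def)
    then show "AE w in Pr x. indicator (space (Pr x)) w * real_op K t (indicator A) (X 0 w) =
        real_op K t (indicator A) x"
      using AE_space by eventually_elim simp
  qed simp
  also have "\<dots> = real_op K t (indicator A) x" by (simp add: prob_space)
  also have "\<dots> = measure (K t x) A"
    unfolding real_op_def using A sets.sets_into_space[OF A]
    by (simp add: sets_K x t space_K space_borel_on Int_absorb1 Int_absorb2)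
  finally show "emeasure (K t x) A = emeasure (distr (Pr x) (borel_on E) (X t)) A"
    by (simp add: emeasure_distr[OF X_measurable[OF x t] A] emeasure_eq_measure K.emeasure_eq_measure)
qed

text \<open>The Feller semigroup is only sub-Markovian by definition; total mass 1 comes from the
  realization, whose values lie in \<open>E\<close> at all times.\<close>

lemma prob_K: "x \<in> E \<Longrightarrow> t \<ge> 0 \<Longrightarrow> prob_space (K t x)"
  unfolding law_X by (intro prob_space.prob_space_distr prob_Pr X_measurable)

text \<open>Time \<open>1 / chi\<close> is the limit of \<open>(1 - exp (- chi * t)) / chi\<close>,
  and 0 is the limit of the contracted starting points.\<close>

definition ou_limit :: "real measure" where
  "ou_limit = K (1 / chi) 0"

lemma ou_limit_eq: "ou_limit = distr (Pr 0) (borel_on E) (\<lambda>w. chi powr (- 1 / \<alpha>) * X 1 w)"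
proof -
  have c: "(chi powr (- 1 / \<alpha>)) powr \<alpha> = 1 / chi"
    using alpha_pos chi_pos by (simp only: powr_powr) (simp add: powr_minus inverse_eq_divide)
  have pos: "chi powr (- 1 / \<alpha>) > 0" using chi_pos by simp
  have "ou_limit = K ((chi powr (- 1 / \<alpha>)) powr \<alpha> * 1) (chi powr (- 1 / \<alpha>) * 0)"
    unfolding ou_limit_def c by simp
  also have "\<dots> = distr (distr (Pr 0) (borel_on E) (X 1)) (borel_on E) ((*) (chi powr (- 1 / \<alpha>)))"
    by (subst kernel_scale[OF pos _ zero_E]) (simp_all add: law_X zero_E)
  also have "\<dots> = distr (Pr 0) (borel_on E) ((*) (chi powr (- 1 / \<alpha>)) \<circ> X 1)"
    by (rule distr_distr[OF measurable_scale[OF pos] X_measurable[OF zero_E]]) simp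
  finally show ?thesis by (simp add: comp_def)
qed

lemma prob_ou_limit: "prob_space ou_limit"
  unfolding ou_limit_def using chi_pos by (intro prob_K zero_E) simp

lemma sets_ou_limit: "sets ou_limit = sets (borel_on E)"
  unfolding ou_limit_def using chi_pos by (intro sets_K zero_E) simp

lemma exp_powr_alpha: "exp (- lam * t) powr \<alpha> = exp (- chi * t)"
  by (simp add: powr_def chi_eq mult_ac)

text \<open>Undoing the dilation by \<open>exp (- lam * (s + t))\<close> multiplies time by
  \<open>exp (- chi * (s + t))\<close>. The elapsed time then no longer depends on \<open>s\<close>,
  and the past enters only through a starting point contracted towards 0.\<close>

lemma ou_shift:
  assumes f: "bounded_borel E f" and s: "s \<ge> 0" and t: "t \<ge> 0" and y: "y \<in> E"
  shows "real_op K (exp (chi * s) * e_chi chi t) (dil (exp (- lam * (s + t))) f) y =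
    real_op K ((1 - exp (- chi * t)) / chi) f (exp (- lam * (s + t)) * y)"
proof -
  have "exp (- chi * (s + t)) * (exp (chi * s) * e_chi chi t) = exp (- chi * t) * e_chi chi t"
    by (simp add: mult.assoc[symmetric] exp_add[symmetric] algebra_simps)
  also have "\<dots> = (1 - exp (- chi * t)) / chi"
    by (simp add: e_chi_def right_diff_distrib exp_add[symmetric])
  finally have eq: "exp (- lam * (s + t)) powr \<alpha> * (exp (chi * s) * e_chi chi t) = (1 - exp (- chi * t)) / chi"
    unfolding exp_powr_alpha .
  have "exp (chi * s) * e_chi chi t \<ge> 0" using e_chi_nonneg[OF t] by simp
  then have "real_op K (exp (- lam * (s + t)) powr \<alpha> * (exp (chi * s) * e_chi chi t)) f (exp (- lam * (s + t)) * y) =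
      real_op K (exp (chi * s) * e_chi chi t) (dil (exp (- lam * (s + t))) f) y"
    using self_sim f y unfolding self_similar_def by (meson exp_gt_zero)
  then show ?thesis unfolding eq by simp
qed

lemma dil_bounded_borel:
  assumes "bounded_borel E f" "c > 0"
  shows "bounded_borel E (dil c f)"
proof -
  have "dil c f \<in> borel_measurable (borel_on E)"
    unfolding dil_def[abs_def] using assms
    by (intro measurable_compose[OF measurable_scale]) (auto simp: bounded_borel_def)
  moreover have "dil c f ` E \<subseteq> f ` E" using E_scale[OF assms(2)] by (auto simp: dil_def)
  ultimately show ?thesis using assms(1) bounded_subset by (auto simp: bounded_borel_def)
qed

text \<open>Writing \<open>max 0 t\<close> keeps the time argument of the kernel non-negative for
  every real \<open>t\<close>, so that measurability and bounds hold along the whole filter and not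
  just eventually.\<close>

lemma ou_tendsto:
  assumes f: "f \<in> C0 E" and y: "y \<in> E"
  shows "((\<lambda>t. real_op K ((1 - exp (- chi * max 0 t)) / chi) f (exp (- lam * (s + max 0 t)) * y))
    \<longlongrightarrow> (\<integral>z. f z \<partial>ou_limit)) at_top"
proof -
  have ev: "\<forall>\<^sub>F t in at_top. t = max 0 (t::real)"
    using eventually_ge_at_top[of 0] by eventually_elim simp
  have "((\<lambda>t. real_op K ((1 - exp (- chi * max 0 t)) / chi) f (exp (- lam * (s + max 0 t)) * y))
    \<longlongrightarrow> real_op K (1 / chi) f 0) at_top"
  proof (rule real_op_tendsto[OF f zero_E])
    have "((\<lambda>t. (1 - exp (- chi * t)) / chi) \<longlongrightarrow> 1 / chi) at_top"
      using chi_pos by real_asymp (simp add: inverse_eq_divide)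
    then show "((\<lambda>t. (1 - exp (- chi * max 0 t)) / chi) \<longlongrightarrow> 1 / chi) at_top"
      by (rule Lim_transform_eventually) (use ev in eventually_elim, simp)
    have "((\<lambda>t. exp (- lam * (s + t)) * y) \<longlongrightarrow> 0) at_top"
      using lam_pos by real_asymp
    then show "((\<lambda>t. exp (- lam * (s + max 0 t)) * y) \<longlongrightarrow> 0) at_top"
      by (rule Lim_transform_eventually) (use ev in eventually_elim, simp)
    show "\<forall>\<^sub>F t in at_top. 0 \<le> (1 - exp (- chi * max 0 t)) / chi \<and> (1 - exp (- chi * max 0 t)) / chi < 1 / chi"
      using chi_pos by (intro always_eventually) (auto simp: divide_less_cancel)
  qed (use chi_pos y in \<open>auto intro!: E_scale always_eventually\<close>)
  then show ?thesis by (simp add: real_op_def ou_limit_def)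
qed

text \<open>The weight \<open>\<phi>\<close> is 1 when the limit identifies an invariant law and the
  indicator of a past event when it expresses mixing.\<close>

lemma ou_integral_tendsto:
  assumes f: "f \<in> C0 E" and M: "finite_measure M" and Y: "Y \<in> M \<rightarrow>\<^sub>M borel_on E"
    and \<phi>: "\<phi> \<in> borel_measurable M" "\<And>w. 0 \<le> \<phi> w" "\<And>w. \<phi> w \<le> (1::real)"
  shows "((\<lambda>t. \<integral>w. \<phi> w * real_op K ((1 - exp (- chi * max 0 t)) / chi) f (exp (- lam * (s + max 0 t)) * Y w) \<partial>M)
    \<longlongrightarrow> (\<integral>w. \<phi> w \<partial>M) * (\<integral>z. f z \<partial>ou_limit)) at_top"
proof -
  interpret finite_measure M by fact
  obtain B where B: "B \<ge> 0" "\<And>x. x \<in> E \<Longrightarrow> \<bar>f x\<bar> \<le> B" using C0_bounded[OF f] by blast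
  have Y_E: "Y w \<in> E" if "w \<in> space M" for w
    using measurable_space[OF Y that] by (simp add: space_borel_on)
  have \<tau>: "(1 - exp (- chi * max 0 t)) / chi \<ge> 0" for t using chi_pos by simp
  let ?h = "\<lambda>t y. real_op K ((1 - exp (- chi * max 0 t)) / chi) f (exp (- lam * (s + max 0 t)) * y)"
  have hm: "(\<lambda>w. ?h t (Y w)) \<in> borel_measurable M" for t
    by (rule measurable_compose[OF measurable_compose[OF Y measurable_scale]
          real_op_measurable[OF \<tau> C0_measurable[OF f]]]) simp
  have hB: "\<bar>?h t y\<bar> \<le> B" if "y \<in> E" for t y
    by (rule real_op_abs_le[OF \<tau> E_scale B(2,1)]) (use that in auto)
  have "((\<lambda>t. \<integral>w. \<phi> w * ?h t (Y w) \<partial>M) \<longlongrightarrow> (\<integral>w. \<phi> w * (\<integral>z. f z \<partial>ou_limit) \<partial>M)) at_top"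
  proof (rule integral_dominated_convergence_at_top[where w="\<lambda>_. B"])
    show "AE w in M. ((\<lambda>t. \<phi> w * ?h t (Y w)) \<longlongrightarrow> \<phi> w * (\<integral>z. f z \<partial>ou_limit)) at_top"
      by (intro AE_I2 tendsto_mult_left ou_tendsto f Y_E)
    have "norm (\<phi> w * ?h t (Y w)) \<le> 1 * B" if "w \<in> space M" for t w
      unfolding norm_mult using \<phi>(2,3)[of w] hB[OF Y_E[OF that], of t] B(1)
      by (intro mult_mono) auto
    then show "\<forall>\<^sub>F t in at_top. AE w in M. norm (\<phi> w * ?h t (Y w)) \<le> B"
      by (intro always_eventually allI AE_I2) simp
  qed (use \<phi>(1) hm in auto)
  then show ?thesis by simp
qed

lemma ou_op_eq:
  assumes "bounded_borel E f" "t \<ge> 0" "y \<in> E"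
  shows "ou_op lam chi (real_op K) t f y = real_op K ((1 - exp (- chi * t)) / chi) f (exp (- lam * t) * y)"
  using ou_shift[OF assms(1) order_refl assms(2,3)] by (simp add: ou_op_def)

text \<open>The times add up to \<open>1 / chi + e_chi chi t = exp (chi * t) / chi\<close>, which
  the dilation rescales to \<open>1 / chi\<close>, while the starting point 0 is fixed by
  dilations.\<close>

lemma invariant_ou_limit: "invariant_prob E (ou_op lam chi (real_op K)) ou_limit"
  unfolding invariant_prob_def
proof (intro conjI allI impI prob_ou_limit sets_ou_limit)
  fix t :: real and f assume t: "t \<ge> 0" and f: "bounded_borel E f"
  have df: "bounded_borel E (dil (exp (- lam * t)) f)" by (rule dil_bounded_borel[OF f]) simp
  then obtain B where B: "\<And>y. y \<in> E \<Longrightarrow> \<bar>dil (exp (- lam * t)) f y\<bar> \<le> B"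
    unfolding bounded_borel_def bounded_iff by auto
  have pos: "1 / chi \<ge> 0" "1 / chi + e_chi chi t \<ge> 0" using chi_pos e_chi_nonneg[OF t] by auto
  have "(\<integral>x. ou_op lam chi (real_op K) t f x \<partial>ou_limit) =
      real_op K (1 / chi) (real_op K (e_chi chi t) (dil (exp (- lam * t)) f)) 0"
    by (simp add: ou_op_def ou_limit_def real_op_def)
  also have "\<dots> = real_op K (1 / chi + e_chi chi t) (dil (exp (- lam * t)) f) 0"
    using df by (intro real_op_add[symmetric, where B=B] pos e_chi_nonneg t zero_E B) (auto simp: bounded_borel_def)
  also have "\<dots> = real_op K (exp (- lam * t) powr \<alpha> * (1 / chi + e_chi chi t)) f (exp (- lam * t) * 0)"
    using self_sim f pos(2) zero_E unfolding self_similar_def by (metis exp_gt_zero)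
  also have "exp (- lam * t) powr \<alpha> * (1 / chi + e_chi chi t) = 1 / chi"
    unfolding exp_powr_alpha using chi_pos
    by (simp add: e_chi_def add_divide_distrib[symmetric] exp_minus inverse_eq_divide)
  finally show "(\<integral>x. ou_op lam chi (real_op K) t f x \<partial>ou_limit) = (\<integral>x. f x \<partial>ou_limit)"
    by (simp only: real_op_def[of K "1 / chi"] ou_limit_def mult_zero_right)
qed

text \<open>Integrals of \<open>C0 E\<close> functions against \<open>m\<close> are constant along
  the flow and converge to those against \<open>ou_limit\<close>; such integrals determine a finite
  measure on the closed set \<open>E\<close>.\<close>

lemma invariant_unique:
  assumes "invariant_prob E (ou_op lam chi (real_op K)) m"
  shows "m = ou_limit"
proof -
  have m: "prob_space m" and sets_m: "sets m = sets (borel_on E)" using assms by (auto simp: invariant_prob_def)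
  interpret prob_space m by fact
  interpret L: prob_space ou_limit by (rule prob_ou_limit)
  have sp: "space m = E" using sets_eq_imp_space_eq[OF sets_m] by (simp add: space_borel_on)
  have id: "(\<lambda>x. x) \<in> m \<rightarrow>\<^sub>M borel_on E" by (simp add: measurable_cong_sets[OF sets_m refl])
  show ?thesis
  proof (rule finite_measure_eqI_C0[OF E_closed finite_measure_axioms L.finite_measure_axioms sets_m sets_ou_limit])
    fix f assume f: "f \<in> C0 E"
    have "((\<lambda>t. \<integral>w. 1 * real_op K ((1 - exp (- chi * max 0 t)) / chi) f (exp (- lam * (0 + max 0 t)) * w) \<partial>m)
        \<longlongrightarrow> (\<integral>w. 1 \<partial>m) * (\<integral>z. f z \<partial>ou_limit)) at_top"
      by (rule ou_integral_tendsto[OF f finite_measure_axioms id]) auto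
    moreover have "(\<integral>w. 1 * real_op K ((1 - exp (- chi * max 0 t)) / chi) f (exp (- lam * (0 + max 0 t)) * w) \<partial>m) =
        (\<integral>x. f x \<partial>m)" for t
    proof -
      have "(\<integral>w. 1 * real_op K ((1 - exp (- chi * max 0 t)) / chi) f (exp (- lam * (0 + max 0 t)) * w) \<partial>m) =
          (\<integral>w. ou_op lam chi (real_op K) (max 0 t) f w \<partial>m)"
        by (rule Bochner_Integration.integral_cong) (simp_all add: ou_op_eq C0_bounded_borel f sp)
      also have "\<dots> = (\<integral>x. f x \<partial>m)"
        using assms C0_bounded_borel[OF f] by (simp add: invariant_prob_def)
      finally show ?thesis .
    qed
    ultimately have "((\<lambda>t::real. \<integral>x. f x \<partial>m) \<longlongrightarrow> (\<integral>z. f z \<partial>ou_limit)) at_top"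
      by (simp add: prob_space)
    then show "(\<integral>x. f x \<partial>m) = (\<integral>x. f x \<partial>ou_limit)"
      by (simp add: tendsto_const_iff)
  qed
qed

lemma ou_mixing:
  assumes x: "x \<in> E" and s: "s \<ge> 0" and f: "f \<in> C0 E"
    and A: "A \<in> sets (natural_filtration (Pr x) X (e_chi chi s))"
  shows "((\<lambda>t. \<integral>w. indicator A w * f (ou_process lam chi X (s + t) w) \<partial>Pr x)
    \<longlongrightarrow> measure (Pr x) A * (\<integral>z. f z \<partial>ou_limit)) at_top"
proof -
  interpret prob_space "Pr x" by (rule prob_Pr[OF x])
  have AM: "A \<in> sets (Pr x)" using A natural_filtration_subalgebra[OF x] by (auto simp: subalgebra_def)
  have es: "e_chi chi s \<ge> 0" by (rule e_chi_nonneg[OF s])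
  have bf: "bounded_borel E f" by (rule C0_bounded_borel[OF f])
  have lim: "((\<lambda>t. \<integral>w. indicator A w * real_op K ((1 - exp (- chi * max 0 t)) / chi) f
        (exp (- lam * (s + max 0 t)) * X (e_chi chi s) w) \<partial>Pr x)
      \<longlongrightarrow> (\<integral>w. indicator A w \<partial>Pr x) * (\<integral>z. f z \<partial>ou_limit)) at_top"
    using AM by (intro ou_integral_tendsto f finite_measure_axioms X_measurable x es) auto
  have eq: "(\<integral>w. indicator A w * real_op K ((1 - exp (- chi * max 0 t)) / chi) f
        (exp (- lam * (s + max 0 t)) * X (e_chi chi s) w) \<partial>Pr x) =
      (\<integral>w. indicator A w * f (ou_process lam chi X (s + t) w) \<partial>Pr x)" if t: "t \<ge> 0" for t
  proof -
    let ?r = "exp (chi * s) * e_chi chi t" and ?g = "dil (exp (- lam * (s + t))) f"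
    have r: "?r \<ge> 0" using e_chi_nonneg[OF t] by simp
    have "(\<integral>w. indicator A w * f (ou_process lam chi X (s + t) w) \<partial>Pr x) =
        (\<integral>w. indicator A w * ?g (X (e_chi chi s + ?r) w) \<partial>Pr x)"
      by (simp add: ou_process_def dil_def e_chi_add)
    also have "\<dots> = (\<integral>w. indicator A w * real_op K ?r ?g (X (e_chi chi s) w) \<partial>Pr x)"
      by (intro markov x es r A dil_bounded_borel bf) simp
    also have "\<dots> = (\<integral>w. indicator A w * real_op K ((1 - exp (- chi * max 0 t)) / chi) f
        (exp (- lam * (s + max 0 t)) * X (e_chi chi s) w) \<partial>Pr x)"
      by (rule Bochner_Integration.integral_cong[OF refl])
        (simp only: ou_shift[OF bf s t X_in_E[OF x es]] max_absorb2[OF t])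
    finally show ?thesis by simp
  qed
  have "\<forall>\<^sub>F t in at_top. (\<integral>w. indicator A w * real_op K ((1 - exp (- chi * max 0 t)) / chi) f
        (exp (- lam * (s + max 0 t)) * X (e_chi chi s) w) \<partial>Pr x) =
      (\<integral>w. indicator A w * f (ou_process lam chi X (s + t) w) \<partial>Pr x)"
    using eventually_ge_at_top[of 0] by eventually_elim (rule eq)
  from Lim_transform_eventually[OF lim this] show ?thesis using AM by simp
qed

end

section \<open>Occupation times and recurrence\<close>

text \<open>The approximating times may coincide with \<open>t\<close>, where
  \<open>at_right t\<close> says nothing; the filter \<open>at t within {t..}\<close> covers
  this.\<close>

lemma tendsto_of_right_limit:
  fixes f :: "real \<Rightarrow> real"
  assumes f: "(f \<longlongrightarrow> f t) (at_right t)" and \<tau>: "\<tau> \<longlonglongrightarrow> t" "\<And>n. t \<le> \<tau> n"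
  shows "(\<lambda>n. f (\<tau> n)) \<longlonglongrightarrow> f t"
proof -
  have "continuous (at t within {t..}) f"
    using f by (simp add: continuous_within at_within_Ici_at_right)
  from continuous_within_tendsto_compose'[OF this _ \<tau>(1)] \<tau>(2) show ?thesis by auto
qed

text \<open>The times \<open>min T (k / n)\<close> approximate \<open>t\<close> from the right while staying below \<open>T\<close>, so only
  the values of \<open>Y\<close> up to time \<open>T\<close> are used. For the natural filtration this gives progressive
  measurability.\<close>

lemma right_continuous_jointly_measurable:
  fixes Y :: "real \<Rightarrow> 'w \<Rightarrow> real"
  assumes T: "T \<ge> 0" and Y: "\<And>t. 0 \<le> t \<Longrightarrow> t \<le> T \<Longrightarrow> Y t \<in> borel_measurable M"
    and rc: "\<And>t w. 0 \<le> t \<Longrightarrow> w \<in> space M \<Longrightarrow> ((\<lambda>t. Y t w) \<longlongrightarrow> Y t w) (at_right t)"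
  shows "(\<lambda>(w, t). Y (max 0 (min T t)) w) \<in> borel_measurable (M \<Otimes>\<^sub>M lborel)"
proof -
  define c where "c t = max 0 (min T t)" for t
  have [measurable]: "c \<in> borel_measurable borel" unfolding c_def by measurable
  define k where "k n t = nat \<lceil>real (Suc n) * c t\<rceil>" for n t
  define \<tau> where "\<tau> n t = min T (real (k n t) / real (Suc n))" for n t
  have c: "0 \<le> c t" "c t \<le> T" for t using T by (auto simp: c_def)
  have k_ge: "real (Suc n) * c t \<le> real (k n t)" and k_le: "real (k n t) \<le> real (Suc n) * c t + 1" for n t
    using c(1)[of t] by (simp_all add: k_def)
  have \<tau>_ge: "c t \<le> \<tau> n t" for n t
    using k_ge[of n t] c(2)[of t] by (simp add: \<tau>_def le_divide_eq mult.commute)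
  have \<tau>_le: "\<tau> n t \<le> c t + 1 / real (Suc n)" for n t
  proof -
    have "real (k n t) / real (Suc n) \<le> (real (Suc n) * c t + 1) / real (Suc n)"
      by (rule divide_right_mono[OF k_le]) simp
    also have "\<dots> = c t + 1 / real (Suc n)" by (simp add: add_divide_distrib del: of_nat_Suc)
    finally show ?thesis by (simp add: \<tau>_def)
  qed
  have \<tau>_lim: "(\<lambda>n. \<tau> n t) \<longlonglongrightarrow> c t" for t
  proof (rule tendsto_sandwich[OF _ _ tendsto_const])
    show "(\<lambda>n. c t + 1 / real (Suc n)) \<longlonglongrightarrow> c t"
      using tendsto_add[OF tendsto_const LIMSEQ_inverse_real_of_nat, of "c t"]
      by (simp add: inverse_eq_divide)
  qed (use \<tau>_ge \<tau>_le in auto)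
  show ?thesis
  proof (rule borel_measurable_LIMSEQ_real)
    show "(\<lambda>n. case p of (w, t) \<Rightarrow> Y (\<tau> n t) w) \<longlonglongrightarrow> (case p of (w, t) \<Rightarrow> Y (max 0 (min T t)) w)"
      if "p \<in> space (M \<Otimes>\<^sub>M lborel)" for p
      using tendsto_of_right_limit[OF rc[OF c(1)] \<tau>_lim \<tau>_ge, of "fst p" "snd p"] that
      by (auto simp: space_pair_measure c_def)
    show "(\<lambda>(w, t). Y (\<tau> n t) w) \<in> borel_measurable (M \<Otimes>\<^sub>M lborel)" for n
    proof -
      have "(\<lambda>p. Y (min T (real i / real (Suc n))) (fst p)) \<in> borel_measurable (M \<Otimes>\<^sub>M lborel)" for i
        using T by (intro measurable_compose[OF measurable_fst Y]) auto
      moreover have "(\<lambda>p. k n (snd p)) \<in> M \<Otimes>\<^sub>M lborel \<rightarrow>\<^sub>M count_space UNIV"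
        unfolding k_def by measurable
      ultimately have "(\<lambda>p. Y (min T (real (k n (snd p)) / real (Suc n))) (fst p)) \<in> borel_measurable (M \<Otimes>\<^sub>M lborel)"
        by (rule measurable_compose_countable)
      then show ?thesis by (simp add: \<tau>_def case_prod_beta')
    qed
  qed
qed

section \<open>Occupation times of \<open>U\<close> and their divergence\<close>

context ou_realization
begin

abbreviation U :: "real \<Rightarrow> 'w \<Rightarrow> real" where
  "U \<equiv> ou_process lam chi X"

lemma U_in_E: "x \<in> E \<Longrightarrow> t \<ge> 0 \<Longrightarrow> w \<in> space (Pr x) \<Longrightarrow> U t w \<in> E"
  unfolding ou_process_def by (intro E_scale X_in_E e_chi_nonneg) auto

lemma U_right_continuous:
  assumes x: "x \<in> E" and w: "w \<in> space (Pr x)" and t: "t \<ge> 0"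
  shows "((\<lambda>t. U t w) \<longlongrightarrow> U t w) (at_right t)"
proof -
  have "((\<lambda>t. X t w) \<longlongrightarrow> X (e_chi chi t) w) (at_right (e_chi chi t))"
    using realization x w e_chi_nonneg[OF t] by (simp add: realization_def cadlag_def)
  moreover have "filterlim (e_chi chi) (at_right (e_chi chi t)) (at_right t)"
    unfolding filterlim_at
  proof (intro conjI)
    have "\<forall>\<^sub>F u in at_right t. u > t" by (rule eventually_at_right_less)
    then show "\<forall>\<^sub>F u in at_right t. e_chi chi u \<in> {e_chi chi t<..} \<and> e_chi chi u \<noteq> e_chi chi t"
      by eventually_elim (use chi_pos in \<open>auto simp: e_chi_def divide_less_cancel divide_cancel_right\<close>)
    have "continuous (at t) (e_chi chi)"
      unfolding e_chi_def using chi_pos by (intro continuous_intros) auto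
    then show "(e_chi chi \<longlongrightarrow> e_chi chi t) (at_right t)"
      using continuous_at_imp_continuous_at_within continuous_within by blast
  qed
  ultimately have "((\<lambda>t. X (e_chi chi t) w) \<longlongrightarrow> X (e_chi chi t) w) (at_right t)"
    by (rule filterlim_compose)
  then show ?thesis
    unfolding ou_process_def by (intro tendsto_intros)
qed

lemma U_adapted:
  assumes "0 \<le> t" "t \<le> T"
  shows "U t \<in> borel_measurable (natural_filtration (Pr x) X (e_chi chi T))"
  unfolding ou_process_def[abs_def]
  by (intro borel_measurable_times borel_measurable_const natural_filtration_measurable
      e_chi_nonneg e_chi_mono assms)

text \<open>The clamped time equals \<open>t\<close> wherever the indicator is nonzero. Clamping
  makes the integrand jointly measurable for the past up to time \<open>n\<close> of
  \<open>U\<close>.\<close>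

definition occupation :: "(real \<Rightarrow> real) \<Rightarrow> nat \<Rightarrow> 'w \<Rightarrow> ennreal" where
  "occupation f n w = (\<integral>\<^sup>+t. ennreal (f (U (max 0 (min (real n) t)) w)) * indicator {0..real n} t \<partial>lborel)"

lemma occupation_joint_measurable:
  assumes x: "x \<in> E" and f: "f \<in> borel_measurable borel"
  shows "(\<lambda>(w, t). ennreal (f (U (max 0 (min (real n) t)) w)) * indicator {0..real n} t)
    \<in> borel_measurable (natural_filtration (Pr x) X (e_chi chi (real n)) \<Otimes>\<^sub>M lborel)"
proof -
  have "(\<lambda>(w, t). U (max 0 (min (real n) t)) w)
      \<in> borel_measurable (natural_filtration (Pr x) X (e_chi chi (real n)) \<Otimes>\<^sub>M lborel)"
    by (intro right_continuous_jointly_measurable U_adapted)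
      (auto simp: space_natural_filtration intro: U_right_continuous[OF x])
  from measurable_compose[OF this f] show ?thesis
    by (simp add: case_prod_beta')
qed

lemma occupation_measurable:
  assumes "x \<in> E" "f \<in> borel_measurable borel"
  shows "occupation f n \<in> borel_measurable (natural_filtration (Pr x) X (e_chi chi (real n)))"
  unfolding occupation_def[abs_def]
  using lborel.borel_measurable_nn_integral[OF occupation_joint_measurable[OF assms]] by simp

lemma occupation_mono: "m \<le> n \<Longrightarrow> occupation f m w \<le> occupation f n w"
  unfolding occupation_def by (intro nn_integral_mono) (auto simp: indicator_def)

lemma nn_integral_occupation:
  assumes x: "x \<in> E" and f: "f \<in> borel_measurable borel" and B: "B \<in> sets (Pr x)"
  shows "(\<integral>\<^sup>+w. indicator B w * occupation f n w \<partial>Pr x) =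
    (\<integral>\<^sup>+t. (\<integral>\<^sup>+w. indicator B w * ennreal (f (U t w)) \<partial>Pr x) * indicator {0..real n} t \<partial>lborel)"
proof -
  let ?c = "\<lambda>t. max 0 (min (real n) t)"
  interpret prob_space "Pr x" by (rule prob_Pr[OF x])
  interpret P: pair_sigma_finite "Pr x" lborel ..
  have sub: "(\<lambda>w. w) \<in> Pr x \<rightarrow>\<^sub>M natural_filtration (Pr x) X s" for s
    using natural_filtration_subalgebra[OF x, of s] by (auto simp: measurable_def subalgebra_def)
  have "(\<lambda>p. (fst p, snd p)) \<in> Pr x \<Otimes>\<^sub>M lborel \<rightarrow>\<^sub>M natural_filtration (Pr x) X (e_chi chi (real n)) \<Otimes>\<^sub>M lborel"
    by (intro measurable_Pair measurable_compose[OF measurable_fst sub] measurable_snd)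
  from measurable_compose[OF this occupation_joint_measurable[OF x f]]
  have [measurable]: "(\<lambda>p. ennreal (f (U (?c (snd p)) (fst p))) * indicator {0..real n} (snd p)) \<in> borel_measurable (Pr x \<Otimes>\<^sub>M lborel)"
    by (simp add: case_prod_beta')
  have [measurable]: "(\<lambda>p. indicator B (fst p) :: ennreal) \<in> borel_measurable (Pr x \<Otimes>\<^sub>M lborel)"
    using B by measurable
  have sec: "(\<lambda>t. ennreal (f (U (?c t) w)) * indicator {0..real n} t) \<in> borel_measurable lborel" if "w \<in> space (Pr x)" for w
    using measurable_Pair2[OF occupation_joint_measurable[OF x f], of w n] that by (simp add: space_natural_filtration)
  have sec': "(\<lambda>w. indicator B w * ennreal (f (U (?c t) w))) \<in> borel_measurable (Pr x)" for t
    by (intro borel_measurable_times_ennreal borel_measurable_indicator B measurable_compose[OF _ measurable_ennreal]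
        measurable_compose[OF _ f] measurable_compose[OF sub[of "e_chi chi (real n)"] U_adapted]) auto
  have "(\<integral>\<^sup>+w. indicator B w * occupation f n w \<partial>Pr x) =
      (\<integral>\<^sup>+w. \<integral>\<^sup>+t. indicator B w * (ennreal (f (U (?c t) w)) * indicator {0..real n} t) \<partial>lborel \<partial>Pr x)"
    unfolding occupation_def by (intro nn_integral_cong nn_integral_cmult[symmetric] sec)
  also have "\<dots> = (\<integral>\<^sup>+t. \<integral>\<^sup>+w. indicator B w * (ennreal (f (U (?c t) w)) * indicator {0..real n} t) \<partial>Pr x \<partial>lborel)"
    by (rule P.Fubini'[symmetric]) (simp add: case_prod_beta')
  also have "\<dots> = (\<integral>\<^sup>+t. (\<integral>\<^sup>+w. indicator B w * ennreal (f (U (?c t) w)) \<partial>Pr x) * indicator {0..real n} t \<partial>lborel)"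
    by (intro nn_integral_cong) (simp add: mult.assoc[symmetric] nn_integral_multc[OF sec'])
  also have "\<dots> = (\<integral>\<^sup>+t. (\<integral>\<^sup>+w. indicator B w * ennreal (f (U t w)) \<partial>Pr x) * indicator {0..real n} t \<partial>lborel)"
    by (intro nn_integral_cong) (auto simp: indicator_def)
  finally show ?thesis .
qed

text \<open>On the event \<open>B\<close> of occupation bounded by \<open>L\<close>, mixing would
  keep the expectation of \<open>f (U t)\<close> above a fixed \<open>\<delta>\<close> for all large
  \<open>t\<close>. The mean occupation on \<open>B\<close> would then grow linearly, against the
  bound \<open>L\<close>. Since mixing concerns past events, it is applied to \<open>D N\<close>,
  which approximates \<open>B\<close> from outside.\<close>

lemma bounded_occupation_null:
  assumes x: "x \<in> E" and f: "f \<in> C0 E" "f \<in> borel_measurable borel"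
    and f01: "\<And>y. 0 \<le> f y" "\<And>y. f y \<le> 1" and pos: "(\<integral>z. f z \<partial>ou_limit) > 0"
  shows "AE w in Pr x. \<not> (\<forall>n. occupation f n w \<le> of_nat L)"
proof -
  interpret prob_space "Pr x" by (rule prob_Pr[OF x])
  let ?F = "\<lambda>n::nat. natural_filtration (Pr x) X (e_chi chi (real n))"
  define a where "a = (\<integral>z. f z \<partial>ou_limit)"
  define D where "D n = {w \<in> space (Pr x). occupation f n w \<le> of_nat L}" for n
  define B where "B = (\<Inter>n. D n)"
  have D_F: "D n \<in> sets (?F n)" for n
  proof -
    have "{w \<in> space (?F n). occupation f n w \<le> of_nat L} \<in> sets (?F n)"
      using occupation_measurable[OF x f(2), of n] by measurable
    then show ?thesis by (simp add: D_def space_natural_filtration)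
  qed
  have D_M [measurable]: "D n \<in> sets (Pr x)" for n
    using D_F natural_filtration_subalgebra[OF x] by (auto simp: subalgebra_def)
  have B_M [measurable]: "B \<in> sets (Pr x)" unfolding B_def by measurable
  have B_D: "B \<subseteq> D n" for n by (auto simp: B_def)
  have U_M: "(\<lambda>w. f (U t w)) \<in> borel_measurable (Pr x)" if "t \<ge> 0" for t
    by (intro measurable_compose[OF _ f(2)] measurable_from_subalg[OF natural_filtration_subalgebra[OF x] U_adapted[OF that order_refl]])
  have int: "integrable (Pr x) (\<lambda>w. indicator A w * f (U t w))" if "t \<ge> 0" "A \<in> sets (Pr x)" for A t
    by (rule integrable_const_bound[where B=1])
      (use U_M[OF that(1)] that(2) f01 in \<open>auto simp: indicator_def intro!: AE_I2\<close>)
  have "measure (Pr x) B = 0"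
  proof (rule ccontr)
    define p where "p = measure (Pr x) B"
    \<comment> \<open>The limit for \<open>D N\<close> is at least
      \<open>p * a = 4 * \<delta>\<close>, hence eventually above \<open>2 * \<delta>\<close>;
      passing to \<open>B\<close> loses less than \<open>\<delta>\<close>, which leaves
      \<open>\<delta>\<close>.\<close>
    define \<delta> where "\<delta> = p * a / 4"
    assume "measure (Pr x) B \<noteq> 0"
    then have p: "p > 0" by (simp add: p_def less_le)
    have a: "a > 0" using pos by (simp add: a_def)
    have \<delta>: "\<delta> > 0" using p a by (simp add: \<delta>_def)
    have "decseq D"
      unfolding decseq_def D_def using occupation_mono order_trans by blast
    then have "(\<lambda>n. measure (Pr x) (D n)) \<longlonglongrightarrow> p"
      unfolding p_def B_def by (intro finite_Lim_measure_decseq) auto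
    then have "\<forall>\<^sub>F n in sequentially. measure (Pr x) (D n) < p + \<delta>"
      by (rule order_tendstoD) (use \<delta> in simp)
    then obtain N where N: "measure (Pr x) (D N) < p + \<delta>"
      by (auto simp: eventually_sequentially)
    have "p \<le> measure (Pr x) (D N)" unfolding p_def by (intro finite_measure_mono B_D D_M)
    then have "p * a \<le> measure (Pr x) (D N) * a" using a by simp
    then have "2 * \<delta> < measure (Pr x) (D N) * a" using mult_pos_pos[OF p a] unfolding \<delta>_def by linarith
    from order_tendstoD(1)[OF ou_mixing[OF x of_nat_0_le_iff f(1) D_F[of N]] this[unfolded a_def]]
    obtain T where T: "\<And>t. t \<ge> T \<Longrightarrow> 2 * \<delta> < (\<integral>w. indicator (D N) w * f (U (real N + t) w) \<partial>Pr x)"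
      by (auto simp: eventually_at_top_linorder)
    define S where "S = real N + max 0 T"
    have S: "S \<ge> 0" by (simp add: S_def)
    have lower: "ennreal \<delta> \<le> (\<integral>\<^sup>+w. indicator B w * ennreal (f (U t w)) \<partial>Pr x)" if t: "t \<ge> S" for t
    proof -
      have t0: "t \<ge> 0" using S t by simp
      have "2 * \<delta> < (\<integral>w. indicator (D N) w * f (U t w) \<partial>Pr x)"
        using T[of "t - real N"] t by (simp add: S_def)
      \<comment> \<open>As \<open>f \<le> 1\<close> and \<open>B\<close> lies in \<open>D N\<close>,
        shrinking the event costs at most the measure of the difference.\<close>
      also have "\<dots> \<le> (\<integral>w. indicator B w * f (U t w) + (indicator (D N) w - indicator B w) \<partial>Pr x)"
      proof (rule integral_mono)
        show "integrable (Pr x) (\<lambda>w. indicator B w * f (U t w) + (indicator (D N) w - indicator B w))"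
          by (intro Bochner_Integration.integrable_add Bochner_Integration.integrable_diff int t0 B_M) (auto simp: less_top[symmetric])
        show "indicator (D N) w * f (U t w) \<le> indicator B w * f (U t w) + (indicator (D N) w - indicator B w)" for w
          using f01[of "U t w"] B_D[of N] by (auto simp: indicator_def)
      qed (intro int t0 D_M)
      also have "\<dots> = (\<integral>w. indicator B w * f (U t w) \<partial>Pr x) + (measure (Pr x) (D N) - p)"
        using int[OF t0 B_M] by (simp add: p_def less_top[symmetric])
      finally have "\<delta> \<le> (\<integral>w. indicator B w * f (U t w) \<partial>Pr x)" using N by simp
      then have "ennreal \<delta> \<le> ennreal (\<integral>w. indicator B w * f (U t w) \<partial>Pr x)" by (rule ennreal_leI)
      also have "\<dots> = (\<integral>\<^sup>+w. ennreal (indicator B w * f (U t w)) \<partial>Pr x)"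
        using f01 by (intro nn_integral_eq_integral[symmetric] int t0 B_M) auto
      also have "\<dots> = (\<integral>\<^sup>+w. indicator B w * ennreal (f (U t w)) \<partial>Pr x)"
        by (intro nn_integral_cong) (auto simp: indicator_def)
      finally show ?thesis .
    qed
    \<comment> \<open>Large enough that the lower bound \<open>\<delta> * (real n - S)\<close> on
      the mean occupation exceeds \<open>L + 1\<close>.\<close>
    obtain n where n: "S + (real L + 1) / \<delta> < real n" using reals_Archimedean2 by blast
    then have nS: "S \<le> real n" using \<delta> S by (smt (verit) divide_nonneg_pos of_nat_0_le_iff)
    have "ennreal (\<delta> * (real n - S)) = (\<integral>\<^sup>+t. ennreal \<delta> * indicator {S..real n} t \<partial>lborel)"
      using nS \<delta> by (simp add: nn_integral_cmult_indicator ennreal_mult)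
    also have "\<dots> \<le> (\<integral>\<^sup>+t. (\<integral>\<^sup>+w. indicator B w * ennreal (f (U t w)) \<partial>Pr x) * indicator {0..real n} t \<partial>lborel)"
      using S lower by (intro nn_integral_mono) (auto simp: indicator_def)
    also have "\<dots> = (\<integral>\<^sup>+w. indicator B w * occupation f n w \<partial>Pr x)"
      by (rule nn_integral_occupation[OF x f(2) B_M, symmetric])
    also have "\<dots> \<le> (\<integral>\<^sup>+w. of_nat L \<partial>Pr x)"
      using B_D[of n] by (intro nn_integral_mono) (auto simp: indicator_def D_def)
    also have "\<dots> = ennreal (real L)" by (simp add: emeasure_space_1 ennreal_of_nat_eq_real_of_nat)
    finally have "\<delta> * (real n - S) \<le> real L" using \<delta> nS by simp
    moreover have "(real L + 1) / \<delta> < real n - S" using n by simp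
    then have "real L + 1 < \<delta> * (real n - S)" using \<delta> by (simp add: divide_less_eq mult.commute)
    ultimately show False by simp
  qed
  then have "B \<in> null_sets (Pr x)" by (simp add: null_sets_def emeasure_eq_measure)
  then show ?thesis
    by (rule AE_I') (auto simp: B_def D_def)
qed

text \<open>The bump of \<open>W\<close> has positive mean under \<open>ou_limit\<close> and is
  dominated by the indicator of \<open>V\<close> along paths in \<open>E\<close>. Time spent in
  \<open>V\<close> therefore dominates every \<open>occupation f n\<close>, and a finite value would
  bound them all by one natural number; there are only countably many such bounds to
  exclude.\<close>

lemma infinite_occupation:
  assumes x: "x \<in> E" and V: "openin (top_of_set E) V" "emeasure ou_limit V > 0"
  shows "AE w in Pr x. (\<integral>\<^sup>+t. indicator {t. t \<ge> 0 \<and> U t w \<in> V} t \<partial>lborel) = \<infinity>"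
proof -
  obtain W where W: "open W" "V = E \<inter> W" using V(1) by (auto simp: openin_open)
  define f where "f = bump 0 W"
  have fC: "f \<in> C0 E" and fm: "f \<in> borel_measurable borel" and f01: "\<And>y. 0 \<le> f y" "\<And>y. f y \<le> 1"
    unfolding f_def by (auto intro: bump_in_C0 E_closed borel_measurable_continuous_onI bump_continuous bump_nonneg bump_le_1)
  interpret L: prob_space ou_limit by (rule prob_ou_limit)
  have space_L: "space ou_limit = E" using sets_eq_imp_space_eq[OF sets_ou_limit] by (simp add: space_borel_on)
  have fL: "f \<in> borel_measurable ou_limit"
    using C0_measurable[OF fC] by (simp add: measurable_cong_sets[OF sets_ou_limit refl])
  have int: "integrable ou_limit f"
    by (rule L.integrable_const_bound[where B=1]) (use fL f01 in auto)
  have "(\<integral>z. f z \<partial>ou_limit) \<noteq> 0"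
  proof
    assume "(\<integral>z. f z \<partial>ou_limit) = 0"
    then have "AE z in ou_limit. f z = 0"
      using integral_nonneg_eq_0_iff_AE[OF int] f01(1) by simp
    then have "AE z in ou_limit. z \<notin> V"
      by eventually_elim (metis IntD2 W bump_pos_iff f_def less_irrefl)
    moreover have "V \<in> sets ou_limit"
      using W by (auto simp: sets_ou_limit sets_restrict_space)
    ultimately have "emeasure ou_limit V = 0"
      using AE_iff_measurable[of V ou_limit "\<lambda>z. z \<notin> V"] sets.sets_into_space by fastforce
    then show False using V(2) by simp
  qed
  then have pos: "(\<integral>z. f z \<partial>ou_limit) > 0"
    using Bochner_Integration.integral_nonneg[of ou_limit f] f01(1) by (simp add: less_le)
  have "AE w in Pr x. \<forall>L. \<not> (\<forall>n. occupation f n w \<le> of_nat L)"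
    unfolding AE_all_countable by (intro allI bounded_occupation_null x fC fm f01 pos)
  then show ?thesis
    using AE_space
  proof eventually_elim
    case (elim w)
    let ?I = "\<integral>\<^sup>+t. indicator {t. t \<ge> 0 \<and> U t w \<in> V} t \<partial>lborel"
    have le: "occupation f n w \<le> ?I" for n
      unfolding occupation_def
    proof (rule nn_integral_mono)
      fix t :: real
      have "ennreal (f (U t w)) \<le> indicator {t. t \<ge> 0 \<and> U t w \<in> V} t" if t: "0 \<le> t"
      proof (cases "U t w \<in> V")
        case True
        then show ?thesis using t f01(2) by simp
      next
        case False
        then have "\<not> 0 < f (U t w)"
          using U_in_E[OF x t elim(2)] W bump_pos_iff[OF W(1)] by (auto simp: f_def)
        then show ?thesis using f01(1)[of "U t w"] by simp
      qed
      then show "ennreal (f (U (max 0 (min (real n) t)) w)) * indicator {0..real n} t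
          \<le> indicator {t. t \<ge> 0 \<and> U t w \<in> V} t"
        by (cases "t \<in> {0..real n}") auto
    qed
    show ?case
    proof (rule ccontr)
      assume "?I \<noteq> \<infinity>"
      then obtain L where "?I < of_nat L" using ennreal_Ex_less_of_nat[of ?I] by (auto simp: less_top)
      then have "\<forall>n. occupation f n w \<le> of_nat L" using le order_trans less_imp_le by blast
      then show False using elim(1) by blast
    qed
  qed
qed

lemma positively_recurrent_ou: "positively_recurrent E (ou_op lam chi (real_op K)) Pr U"
  unfolding positively_recurrent_def
  using invariant_ou_limit infinite_occupation by blast

end

theorem theorem1p2:
  fixes \<alpha> lam chi :: real and E :: "real set"
    and K :: "real \<Rightarrow> real \<Rightarrow> real measure"
    and Pr :: "real \<Rightarrow> 'w measure" and X :: "real \<Rightarrow> 'w \<Rightarrow> real"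
    and N :: "'v measure" and \<xi> :: "real \<Rightarrow> 'v \<Rightarrow> real"
  assumes "\<alpha> > 0" and "lam > 0" and "chi = \<alpha> * lam"
    and "E \<in> {UNIV, {0<..}, {0..}}"
    and "feller_semigroup E K" and "self_similar \<alpha> E K"
  shows
    "(realization E K Pr X \<and> (E = UNIV \<or> H0 E \<alpha> Pr X N \<xi>) \<longrightarrow>
       positively_recurrent E (ou_op lam chi (real_op K)) Pr (ou_process lam chi X) \<and>
       (\<forall>m. invariant_prob E (ou_op lam chi (real_op K)) m \<longleftrightarrow>
            m = distr (Pr 0) (borel_on E) (\<lambda>w. chi powr (- 1 / \<alpha>) * X 1 w)))
     \<and>
     (\<forall>h p. p > 0 \<and> L1 (gamma_law p) h \<longrightarrow>
       (\<forall>q>0.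
          (invariant E (nn_op K) 1 h \<longrightarrow>
             invariant E (ou_op lam chi (nn_op K)) q (gamma_mix \<alpha> chi h q)) \<and>
          (excessive E (nn_op K) 1 h \<longrightarrow>
             excessive E (ou_op lam chi (nn_op K)) q (gamma_mix \<alpha> chi h q))))
     \<and>
     (\<forall>h p. p > 0 \<and> L1 (gamma_law p) h \<and> invariant E (nn_op K) 1 h \<longrightarrow>
       (\<forall>q>0. \<forall>x\<in>E. \<forall>t\<ge>0.
          ennreal ((1 + chi * t) powr (- q / chi)) *
            nn_op K t (dil ((1 + chi * t) powr (- 1 / \<alpha>)) (gamma_mix \<alpha> chi h q)) x =
          gamma_mix \<alpha> chi h q x))"
proof (intro conjI)
  interpret self_similar_feller \<alpha> E K
    using assms by unfold_locales
  show "realization E K Pr X \<and> (E = UNIV \<or> H0 E \<alpha> Pr X N \<xi>) \<longrightarrow>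
       positively_recurrent E (ou_op lam chi (real_op K)) Pr (ou_process lam chi X) \<and>
       (\<forall>m. invariant_prob E (ou_op lam chi (real_op K)) m \<longleftrightarrow>
            m = distr (Pr 0) (borel_on E) (\<lambda>w. chi powr (- 1 / \<alpha>) * X 1 w))"
  proof (intro impI)
    assume asm: "realization E K Pr X \<and> (E = UNIV \<or> H0 E \<alpha> Pr X N \<xi>)"
    \<comment> \<open>The state space is the line or \<open>{0..}\<close>: it contains the limit
      point 0 of the contracted starting points, and closedness makes decaying functions members of
      \<open>C0 E\<close>.\<close>
    then have "closed E" "0 \<in> E" by (auto simp: H0_def)
    then interpret ou_realization \<alpha> E K lam chi Pr X
      using asm assms by unfold_locales auto
    show "positively_recurrent E (ou_op lam chi (real_op K)) Pr (ou_process lam chi X) \<and>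
       (\<forall>m. invariant_prob E (ou_op lam chi (real_op K)) m \<longleftrightarrow>
            m = distr (Pr 0) (borel_on E) (\<lambda>w. chi powr (- 1 / \<alpha>) * X 1 w))"
      using positively_recurrent_ou invariant_ou_limit invariant_unique
      unfolding ou_limit_eq[symmetric] by blast
  qed
  show "\<forall>h p. p > 0 \<and> L1 (gamma_law p) h \<longrightarrow>
       (\<forall>q>0.
          (invariant E (nn_op K) 1 h \<longrightarrow>
             invariant E (ou_op lam chi (nn_op K)) q (gamma_mix \<alpha> chi h q)) \<and>
          (excessive E (nn_op K) 1 h \<longrightarrow>
             excessive E (ou_op lam chi (nn_op K)) q (gamma_mix \<alpha> chi h q)))"
    using invariant_gamma_mix excessive_gamma_mix assms(2,3) by blast
  show "\<forall>h p. p > 0 \<and> L1 (gamma_law p) h \<and> invariant E (nn_op K) 1 h \<longrightarrow>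
       (\<forall>q>0. \<forall>x\<in>E. \<forall>t\<ge>0.
          ennreal ((1 + chi * t) powr (- q / chi)) *
            nn_op K t (dil ((1 + chi * t) powr (- 1 / \<alpha>)) (gamma_mix \<alpha> chi h q)) x =
          gamma_mix \<alpha> chi h q x)"
    using self_similar_gamma_mix assms(2,3) by blast
qed

end
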